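(* Let $\mathrm{K}_V^{\mathbf t}$ be a complete $\mathbf t$-spread $d$-partite hypergraph with $V(\mathrm{K}_V^{\mathbf t})\subseteq[n]$ and $V=\{V_1,\dots,V_d\}$, where $|V_j|=n_j$ and $V_j=[i_j,i_j+n_j-1]$ for all $j=1,\dots,d$. Then $\mathcal{G}(I(\mathrm{K}_V^{\mathbf t})^\vee)$ consists of the following monomials: (i) $\prod_{k\in V_i}x_k$ for all $i=1,\dots,d$; and (ii) $$\Big(\prod_{i=j}^{p}\prod_{k\in V_i}x_k\Big)\Big/\Big(\prod_{i=j}^{p-1}v_{q_i}\ \prod_{i=j+1}^{p}v_{q'_i}\Big)$$ for all $1\le j<p\le d$ and for each sequence of nonnegative integers $q_j,\dots,q_{p-1}$ for which there are nonnegative integers $q'_{j+1},\dots,q'_p$ satisfying $$i_\ell+q'_\ell<i_\ell+n_\ell-1-q_\ell\quad\text{for } j+1\le\ell\le p-1,$$ $$i_\ell+q'_\ell-(i_{\ell-1}+n_{\ell-1}-1-q_{\ell-1})=t_{\ell-1}-1\quad\text{for }\ell=j+1,\dots,p,$$ where $v_{q_\ell}=\prod_{r=1}^{1+q_\ell}x_{i_\ell+n_\ell-r}$ for $\ell=j,\dots,p-1$ and $v_{q'_\ell}=\prod_{r=0}^{q'_\ell}x_{i_\ell+r}$ for $\ell=j+1,\dots,p$.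
   Context: Setting. Let $n,d\ge 1$ be integers, $[n]=\{1,\dots,n\}$, $[a,b]=\{k\in\mathbb{Z}:a\le k\le b\}$, and let $\mathbf t=(t_1,\dots,t_{d-1})$ be a vector of integers with $t_i\ge 1$ for all $i$. Let $V=\{V_1,\dots,V_d\}$ be a family of nonempty, pairwise disjoint subsets of $[n]$ such that $p<q$ whenever $p\in V_i$, $q\in V_j$ and $i<j$. A $\mathbf t$-spread edge is a set $\{k_1,\dots,k_d\}$ with $k_j\in V_j$ for $j=1,\dots,d$ and $k_j-k_{j-1}\ge t_{j-1}$ for $j=2,\dots,d$. The complete $\mathbf t$-spread $d$-partite hypergraph $\mathrm{K}_V^{\mathbf t}$ is the hypergraph with vertex set $V(\mathrm{K}_V^{\mathbf t})=V_1\cup\dots\cup V_d$ whose edges are all the $\mathbf t$-spread edges. Standing assumption: $\mathrm{K}_V^{\mathbf t}$ has no isolated vertices, i.e. every vertex belongs to at least one edge. Let $\mathbb{K}$ be a field and $S=\mathbb{K}[x_1,\dots,x_n]$. The edge ideal $I(\mathrm{K}_V^{\mathbf t})\subset S$ is the ideal generated by the monomials $x_{k_1}\cdots x_{k_d}$, where $\{k_1,\dots,k_d\}$ runs over the edges of $\mathrm{K}_V^{\mathbf t}$. $\mathcal{G}(I)$ denotes the unique minimal set of monomial generators of a monomial ideal $I$. For a square-free monomial ideal $I$, its Alexander dual is $I^\vee=\bigcap_{u\in\mathcal{G}(I)}(x_i : x_i \text{ divides } u)$. *)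

theory Defs
  imports "HOL-Library.Poly_Mapping" "HOL-Algebra.Ideal" "HOL-Algebra.Divisibility"
begin

text \<open>
  A polynomial over \<open>'k\<close> in variables indexed by natural numbers is a finitely supported
  map from exponent vectors to coefficients.  The ring \<open>S = K[x_1,\<dots>,x_n]\<close> consists of those
  polynomials in which only the variables \<open>x_1,\<dots>,x_n\<close> occur; ideals are ideals of this ring.
\<close>

type_synonym 'k mpoly = "(nat \<Rightarrow>\<^sub>0 nat) \<Rightarrow>\<^sub>0 'k"

definition mpoly_ring :: "nat \<Rightarrow> ('k::field mpoly) ring" where
  "mpoly_ring n =
     \<lparr> carrier = {f. \<forall>m \<in> Poly_Mapping.keys f. Poly_Mapping.keys m \<subseteq> {1..n}},
       monoid.mult = (*), one = 1, zero = 0, add = (+) \<rparr>"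

lemma cring_mpoly_ring: "cring (mpoly_ring n :: ('k::field mpoly) ring)"
proof (rule cringI)
  let ?S = "mpoly_ring n :: 'k mpoly ring"
  have S_iff: "f \<in> carrier ?S \<longleftrightarrow>
      (\<forall>m. m \<in> Poly_Mapping.keys f \<longrightarrow> Poly_Mapping.keys m \<subseteq> {1..n})" for f
    by (auto simp only: mpoly_ring_def partial_object.simps)
  have add: "f + g \<in> carrier ?S" if "f \<in> carrier ?S" "g \<in> carrier ?S" for f g
    using that Poly_Mapping.keys_add[of f g] unfolding S_iff by blast
  have mult: "f * g \<in> carrier ?S" if f: "f \<in> carrier ?S" and g: "g \<in> carrier ?S" for f g
    unfolding S_iff
  proof (intro allI impI)
    fix m assume "m \<in> Poly_Mapping.keys (f * g)"
    then obtain a b where ab: "a \<in> Poly_Mapping.keys f" "b \<in> Poly_Mapping.keys g" "m = a + b"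
      using Poly_Mapping.keys_mult[of f g] by blast
    have "Poly_Mapping.keys a \<subseteq> {1..n}" "Poly_Mapping.keys b \<subseteq> {1..n}"
      using f g ab unfolding S_iff by blast+
    then show "Poly_Mapping.keys m \<subseteq> {1..n}"
      using Poly_Mapping.keys_add[of a b] unfolding ab(3) by blast
  qed
  have zero: "0 \<in> carrier ?S" and one: "1 \<in> carrier ?S"
    unfolding S_iff by simp_all
  have uminus: "- f \<in> carrier ?S" if "f \<in> carrier ?S" for f
    using that unfolding S_iff by simp
  have ops: "f \<oplus>\<^bsub>?S\<^esub> g = f + g" "f \<otimes>\<^bsub>?S\<^esub> g = f * g" "\<zero>\<^bsub>?S\<^esub> = 0" "\<one>\<^bsub>?S\<^esub> = 1" for f g
    by (simp_all add: mpoly_ring_def)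
  show "abelian_group ?S"
  proof (rule abelian_groupI, unfold ops)
    show "\<exists>g\<in>carrier ?S. g + f = 0" if "f \<in> carrier ?S" for f
      using uminus[OF that] by (rule bexI[rotated]) simp
  qed (simp_all add: add zero add.assoc add.commute)
  show "Group.comm_monoid ?S"
    by (rule comm_monoidI, unfold ops) (simp_all add: mult one mult.assoc mult.commute)
  show "(f \<oplus>\<^bsub>?S\<^esub> g) \<otimes>\<^bsub>?S\<^esub> h = f \<otimes>\<^bsub>?S\<^esub> h \<oplus>\<^bsub>?S\<^esub> g \<otimes>\<^bsub>?S\<^esub> h" for f g h
    unfolding ops by (rule distrib_right)
qed

definition mvar :: "nat \<Rightarrow> 'k::field mpoly" where
  "mvar i = Poly_Mapping.single (Poly_Mapping.single i 1) 1"

definition monomials :: "nat \<Rightarrow> ('k::field mpoly) set" where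
  "monomials n = {Poly_Mapping.single m 1 | m. Poly_Mapping.keys m \<subseteq> {1..n}}"

text \<open>
  \<open>\<G>(I)\<close>: the unique inclusion-minimal set of monomials of \<open>S\<close> generating \<open>I\<close>.
  It is meaningful only for monomial ideals.
\<close>

definition min_gens :: "nat \<Rightarrow> ('k::field mpoly) set \<Rightarrow> ('k mpoly) set" where
  "min_gens n I =
     (THE G. G \<subseteq> monomials n \<and> genideal (mpoly_ring n) G = I \<and>
             (\<forall>H. H \<subset> G \<longrightarrow> genideal (mpoly_ring n) H \<noteq> I))"

text \<open>
  The intersection is taken inside \<open>S\<close>, so that the empty intersection is \<open>S\<close>.
\<close>

definition alexander_dual :: "nat \<Rightarrow> ('k::field mpoly) set \<Rightarrow> ('k mpoly) set" where
  "alexander_dual n I = carrier (mpoly_ring n) \<inter>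
     (\<Inter>u \<in> min_gens n I.
        genideal (mpoly_ring n)
          {mvar i | i. i \<in> {1..n} \<and> mvar i divides\<^bsub>mpoly_ring n\<^esub> u})"

text \<open>
  The quotient of \<open>f\<close> by \<open>g\<close> in \<open>S\<close>, meaningful only if \<open>g \<noteq> 0\<close> divides \<open>f\<close> in \<open>S\<close>.
\<close>

definition mquot :: "nat \<Rightarrow> 'k::field mpoly \<Rightarrow> 'k mpoly \<Rightarrow> 'k mpoly" where
  "mquot n f g = (THE h. h \<in> carrier (mpoly_ring n) \<and> h * g = f)"

text \<open>A hypergraph is a pair of a vertex set and a set of edges.\<close>

type_synonym hypergraph = "nat set \<times> nat set set"

definition no_isolated_vertices :: "hypergraph \<Rightarrow> bool" where
  "no_isolated_vertices H \<longleftrightarrow> (\<forall>v \<in> fst H. \<exists>e \<in> snd H. v \<in> e)"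

definition edge_ideal :: "nat \<Rightarrow> hypergraph \<Rightarrow> ('k::field mpoly) set" where
  "edge_ideal n H = genideal (mpoly_ring n) {(\<Prod>k\<in>e. mvar k) | e. e \<in> snd H}"

text \<open>
  Families and vectors are functions on \<open>nat\<close>; only \<open>V 1,\<dots>,V d\<close> and \<open>t 1,\<dots>,t (d - 1)\<close> matter.
\<close>

definition vertex_family :: "nat \<Rightarrow> nat \<Rightarrow> (nat \<Rightarrow> nat set) \<Rightarrow> bool" where
  "vertex_family n d V \<longleftrightarrow>
     (\<forall>i\<in>{1..d}. V i \<noteq> {} \<and> V i \<subseteq> {1..n}) \<and>
     (\<forall>i\<in>{1..d}. \<forall>j\<in>{1..d}. i \<noteq> j \<longrightarrow> V i \<inter> V j = {}) \<and>
     (\<forall>i\<in>{1..d}. \<forall>j\<in>{1..d}. i < j \<longrightarrow> (\<forall>p\<in>V i. \<forall>q\<in>V j. p < q))"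

definition spread_edges :: "nat \<Rightarrow> (nat \<Rightarrow> nat) \<Rightarrow> (nat \<Rightarrow> nat set) \<Rightarrow> nat set set" where
  "spread_edges d t V =
     {k ` {1..d} | k. (\<forall>j\<in>{1..d}. k j \<in> V j) \<and>
                      (\<forall>j\<in>{2..d}. int (k j) - int (k (j - 1)) \<ge> int (t (j - 1)))}"

definition complete_spread_hypergraph ::
    "nat \<Rightarrow> (nat \<Rightarrow> nat) \<Rightarrow> (nat \<Rightarrow> nat set) \<Rightarrow> hypergraph" where
  "complete_spread_hypergraph d t V = ((\<Union>j\<in>{1..d}. V j), spread_edges d t V)"

text \<open>
  \<open>vlast i m q l\<close> and \<open>vfirst i q' l\<close> are the products of the last \<open>1 + q l\<close> and of the first
  \<open>1 + q' l\<close> variables of the interval \<open>[i l, i l + m l - 1]\<close>.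
\<close>

definition vlast :: "(nat \<Rightarrow> nat) \<Rightarrow> (nat \<Rightarrow> nat) \<Rightarrow> (nat \<Rightarrow> nat) \<Rightarrow> nat \<Rightarrow> 'k::field mpoly" where
  "vlast i m q l = (\<Prod>r=1..1 + q l. mvar (i l + m l - r))"

definition vfirst :: "(nat \<Rightarrow> nat) \<Rightarrow> (nat \<Rightarrow> nat) \<Rightarrow> nat \<Rightarrow> 'k::field mpoly" where
  "vfirst i q' l = (\<Prod>r=0..q' l. mvar (i l + r))"

text \<open>
  The two conditions relating \<open>q j,\<dots>,q (p - 1)\<close> and \<open>q' (j + 1),\<dots>,q' p\<close>, stated over the
  integers because of the subtractions.
\<close>

definition admissible ::
    "(nat \<Rightarrow> nat) \<Rightarrow> (nat \<Rightarrow> nat) \<Rightarrow> (nat \<Rightarrow> nat) \<Rightarrow> nat \<Rightarrow> nat \<Rightarrow> (nat \<Rightarrow> nat) \<Rightarrow> (nat \<Rightarrow> nat) \<Rightarrow> bool" where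
  "admissible t i m j p q q' \<longleftrightarrow>
     (\<forall>l\<in>{j+1..p-1}. int (i l) + int (q' l) < int (i l) + int (m l) - 1 - int (q l)) \<and>
     (\<forall>l\<in>{j+1..p}.
        int (i l) + int (q' l) - (int (i (l-1)) + int (m (l-1)) - 1 - int (q (l-1)))
          = int (t (l-1)) - 1)"

end

theory Submission
  imports Defs
begin

text \<open>
  By Alexander duality, the minimal generators of the dual of a square-free monomial ideal correspond
  to the minimal vertex covers of the hypergraph: a monomial lies in the intersection of the prime
  ideals \<open>(x_k : k \<in> e)\<close> exactly if its support meets every edge \<open>e\<close> (\<open>min_gens_alexander_dual\<close>). So
  the theorem is a description of the minimal vertex covers.

  An edge is a chain \<open>s 1, \<dots>, s d\<close> with \<open>s l \<in> V l\<close> and \<open>s l + t l \<le> s (l + 1)\<close>. Trying to build an edge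
  that avoids a given cover \<open>C\<close>, always with the smallest possible vertex \<open>r l\<close>, must fail on entering
  some class \<open>p\<close>. All vertices that were tried and rejected lie in \<open>C\<close>: in class \<open>l\<close> these are the
  vertices from \<open>r (l - 1) + t (l - 1)\<close> up to, but not including, \<open>r l\<close>, and for \<open>l = p\<close> up to the end of the
  class. If in some class even the first vertex was reachable, the earlier classes can be forgotten, since
  then every edge enters that class in the range under consideration. Starting from the last such
  class \<open>j\<close>, the rejected vertices form a ``block'', so every cover contains a block
  (\<open>cover_contains_block\<close>).

  Conversely a block is a cover, since an edge avoiding it would have to stay at or above all the
  thresholds \<open>r l\<close> and could not cross class \<open>p\<close> (\<open>chain_meets_block\<close>). It is a minimal one, since for
  each of its vertices there is an edge meeting it only there (\<open>block_critical\<close>); this uses that the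
  classes are intervals and that no vertex is isolated. Hence the minimal covers are exactly the
  blocks.

  Finally, a block is \<open>V j \<union> \<dots> \<union> V p\<close> without the last \<open>1 + q l\<close> vertices of the classes before \<open>p\<close>, where
  \<open>q l\<close> is the distance of \<open>r l\<close> from the right end of class \<open>l\<close>, and without the first \<open>1 + q' l\<close> vertices of the
  classes after \<open>j\<close>, those below \<open>r (l - 1) + t (l - 1)\<close>. Translating the conditions on the thresholds gives
  the admissibility conditions, and the monomial of the block is the displayed quotient
  (\<open>mquot_eq_block\<close>). A block with \<open>j = p\<close> is a whole class.
\<close>

section \<open>Ideals generated by monomials\<close>

abbreviation monom :: "(nat \<Rightarrow>\<^sub>0 nat) \<Rightarrow> 'k::field mpoly" where
  "monom g \<equiv> Poly_Mapping.single g 1"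

lemma mem_carrier_mpoly_ring:
  "f \<in> carrier (mpoly_ring n) \<longleftrightarrow> (\<forall>m\<in>Poly_Mapping.keys f. Poly_Mapping.keys m \<subseteq> {1..n})"
  by (simp add: mpoly_ring_def)

lemma mpoly_ring_ops:
  "f \<oplus>\<^bsub>mpoly_ring n\<^esub> g = f + g" "f \<otimes>\<^bsub>mpoly_ring n\<^esub> g = f * g"
  "\<zero>\<^bsub>mpoly_ring n\<^esub> = 0" "\<one>\<^bsub>mpoly_ring n\<^esub> = 1"
  by (simp_all add: mpoly_ring_def)

lemma single_in_carrier:
  "Poly_Mapping.keys m \<subseteq> {1..n} \<Longrightarrow> Poly_Mapping.single m c \<in> carrier (mpoly_ring n)"
  by (simp add: mem_carrier_mpoly_ring)

lemma poly_mapping_eq_sum_single: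
  "f = (\<Sum>m\<in>Poly_Mapping.keys f. Poly_Mapping.single m (Poly_Mapping.lookup f m))"
proof (rule poly_mapping_eqI)
  fix a
  show "Poly_Mapping.lookup f a = Poly_Mapping.lookup
      (\<Sum>m\<in>Poly_Mapping.keys f. Poly_Mapping.single m (Poly_Mapping.lookup f m)) a"
    by (simp add: lookup_sum lookup_single when_def in_keys_iff)
qed

lemma exponent_diff_add:
  fixes g m :: "nat \<Rightarrow>\<^sub>0 nat"
  assumes "Poly_Mapping.lookup g \<le> Poly_Mapping.lookup m"
  shows "(m - g) + g = m"
  using assms by (intro poly_mapping_eqI) (auto simp: lookup_add lookup_minus le_fun_def)

lemma keys_exponent_diff:
  fixes g m :: "nat \<Rightarrow>\<^sub>0 nat"
  shows "Poly_Mapping.keys (m - g) \<subseteq> Poly_Mapping.keys m"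
  by (auto simp: in_keys_iff lookup_minus)

text \<open>
  Divisibility of monomials is the pointwise order on exponents. The right-hand side is an ideal
  because every exponent of a product is a sum that dominates an exponent of each factor; conversely,
  each term of such an \<open>f\<close> is a multiple of a generator, and \<open>f\<close> is the sum of its terms. Membership
  in a monomial ideal thereby becomes a condition on exponents, so that intersections of such ideals
  can be read off directly.
\<close>

lemma genideal_monomials:
  fixes M :: "(nat \<Rightarrow>\<^sub>0 nat) set"
  assumes M: "\<forall>g\<in>M. Poly_Mapping.keys g \<subseteq> {1..n}"
  shows "genideal (mpoly_ring n) (monom ` M :: 'k::field mpoly set) =
    {f \<in> carrier (mpoly_ring n).
       \<forall>m\<in>Poly_Mapping.keys f. \<exists>g\<in>M. Poly_Mapping.lookup g \<le> Poly_Mapping.lookup m}"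
    (is "_ = ?I")
proof
  let ?S = "mpoly_ring n :: 'k mpoly ring"
  interpret S: cring ?S by (rule cring_mpoly_ring)
  have subset_carrier: "monom ` M \<subseteq> carrier ?S"
    using M by (blast intro: single_in_carrier)
  have mult_closed: "x * a \<in> ?I" if a: "a \<in> ?I" and x: "x \<in> carrier ?S" for a x
  proof -
    have "\<exists>g\<in>M. Poly_Mapping.lookup g \<le> Poly_Mapping.lookup m"
      if "m \<in> Poly_Mapping.keys (x * a)" for m
    proof -
      obtain u v where v: "v \<in> Poly_Mapping.keys a" and m: "m = u + v"
        using Poly_Mapping.keys_mult[of x a] \<open>m \<in> _\<close> by blast
      obtain g where "g \<in> M" and "Poly_Mapping.lookup g \<le> Poly_Mapping.lookup v"
        using a v by blast
      then show ?thesis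
        by (intro bexI[of _ g]) (auto simp: m lookup_add le_fun_def intro: trans_le_add2)
    qed
    then show ?thesis
      using S.m_closed[OF x] a by (simp add: mpoly_ring_ops)
  qed
  have "ideal ?I ?S"
  proof (rule idealI)
    show "ring ?S" by (rule S.ring_axioms)
    show "x \<otimes>\<^bsub>?S\<^esub> a \<in> ?I" if "a \<in> ?I" "x \<in> carrier ?S" for a x
      unfolding mpoly_ring_ops using that by (rule mult_closed)
    show "a \<otimes>\<^bsub>?S\<^esub> x \<in> ?I" if "a \<in> ?I" "x \<in> carrier ?S" for a x
      unfolding mpoly_ring_ops mult.commute[of a] using that by (rule mult_closed)
    have minus_closed: "- a \<in> ?I" if "a \<in> ?I" for a
      using that by (simp add: mem_carrier_mpoly_ring)
    show "subgroup ?I (add_monoid ?S)"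
    proof (rule group.subgroupI[OF S.a_group])
      show "?I \<subseteq> carrier (add_monoid ?S)" by auto
      show "?I \<noteq> {}"
        using S.zero_closed by (auto simp: mpoly_ring_ops intro!: exI[of _ 0])
      show "inv\<^bsub>add_monoid ?S\<^esub> a \<in> ?I" if a: "a \<in> ?I" for a
      proof -
        have "\<ominus>\<^bsub>?S\<^esub> a = - a"
          using a minus_closed[OF a]
          by (intro S.minus_equality) (simp_all add: mpoly_ring_ops)
        then show ?thesis using minus_closed[OF a] by (simp add: a_inv_def)
      qed
      show "a \<otimes>\<^bsub>add_monoid ?S\<^esub> b \<in> ?I" if "a \<in> ?I" "b \<in> ?I" for a b
        using that S.a_closed[of a b] Poly_Mapping.keys_add[of a b]
        by (auto simp: mpoly_ring_ops)
    qed
  qed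
  moreover have "monom ` M \<subseteq> ?I"
    using subset_carrier by auto
  ultimately show "genideal ?S (monom ` M) \<subseteq> ?I"
    by (rule S.genideal_minimal)

  interpret J: ideal "genideal ?S (monom ` M)" ?S
    using subset_carrier by (rule S.genideal_ideal)
  let ?J = "genideal ?S (monom ` M)"
  show "?I \<subseteq> ?J"
  proof
    fix f assume f: "f \<in> ?I"
    have "Poly_Mapping.single m (Poly_Mapping.lookup f m) \<in> ?J"
      if m: "m \<in> Poly_Mapping.keys f" for m
    proof -
      obtain g where g: "g \<in> M" and le: "Poly_Mapping.lookup g \<le> Poly_Mapping.lookup m"
        using f m by blast
      have "Poly_Mapping.single (m - g) (Poly_Mapping.lookup f m) \<in> carrier ?S"
        using f m keys_exponent_diff[of m g]
        by (intro single_in_carrier) (auto simp: mem_carrier_mpoly_ring)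
      moreover have "monom g \<in> ?J"
        using S.genideal_self[OF subset_carrier] g by blast
      ultimately have "Poly_Mapping.single (m - g) (Poly_Mapping.lookup f m) * monom g \<in> ?J"
        using J.I_l_closed by (simp add: mpoly_ring_ops)
      then show ?thesis
        by (simp add: mult_single exponent_diff_add[OF le])
    qed
    moreover have "(\<Sum>m\<in>K. h m) \<in> ?J" if "finite K" "\<And>m. m \<in> K \<Longrightarrow> h m \<in> ?J"
      for K and h :: "(nat \<Rightarrow>\<^sub>0 nat) \<Rightarrow> 'k mpoly"
      using that
    proof (induction K)
      case empty
      then show ?case using J.zero_closed by (simp add: mpoly_ring_ops)
    next
      case (insert x K)
      then show ?case using J.a_closed[of "h x"] by (simp add: mpoly_ring_ops)
    qed
    ultimately show "f \<in> ?J"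
      by (subst poly_mapping_eq_sum_single) simp
  qed
qed

lemma monom_in_genideal_iff:
  assumes "\<forall>g\<in>M. Poly_Mapping.keys g \<subseteq> {1..n}" and "Poly_Mapping.keys m \<subseteq> {1..n}"
  shows "monom m \<in> genideal (mpoly_ring n) (monom ` M :: 'k::field mpoly set) \<longleftrightarrow>
    (\<exists>g\<in>M. Poly_Mapping.lookup g \<le> Poly_Mapping.lookup m)"
  by (simp add: genideal_monomials[OF assms(1)] single_in_carrier[OF assms(2)])

text \<open>
  If monomials \<open>G\<close> generate the same ideal as the antichain \<open>M\<close>, then each \<open>g \<in> M\<close> is divisible by
  some \<open>h \<in> G\<close>, which in turn is divisible by some \<open>g' \<in> M\<close>; the antichain property forces
  \<open>g' = h = g\<close>. So \<open>M\<close> is contained in every monomial generating set, which gives both its minimality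
  and the uniqueness that the definite description in \<^const>\<open>min_gens\<close> requires.
\<close>

lemma min_gens_antichain:
  fixes M :: "(nat \<Rightarrow>\<^sub>0 nat) set"
  assumes M: "\<forall>g\<in>M. Poly_Mapping.keys g \<subseteq> {1..n}"
    and antichain: "\<And>g h. \<lbrakk>g \<in> M; h \<in> M; Poly_Mapping.lookup g \<le> Poly_Mapping.lookup h\<rbrakk> \<Longrightarrow> g = h"
  shows "min_gens n (genideal (mpoly_ring n) (monom ` M :: 'k::field mpoly set)) = monom ` M"
    (is "min_gens n ?I = _")
  unfolding min_gens_def
proof (rule the_equality, intro conjI allI impI)
  show "monom ` M \<subseteq> monomials n"
    using M by (auto simp: monomials_def)
  show "genideal (mpoly_ring n) H \<noteq> ?I" if H: "H \<subset> monom ` M" for H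
  proof
    assume eq: "genideal (mpoly_ring n) H = ?I"
    obtain N where N: "N \<subseteq> M" "H = monom ` N"
      using H by (meson psubset_imp_subset subset_imageE)
    obtain g where g: "g \<in> M" "g \<notin> N"
      using H N by blast
    have "(monom g :: 'k mpoly) \<in> ?I"
      using g M by (subst monom_in_genideal_iff) auto
    then obtain h where "h \<in> N" "Poly_Mapping.lookup h \<le> Poly_Mapping.lookup g"
      using eq N g M monom_in_genideal_iff[of N n g] by blast
    then show False
      using antichain[of h g] N g by blast
  qed
next
  fix G :: "'k mpoly set"
  assume G: "G \<subseteq> monomials n \<and> genideal (mpoly_ring n) G = ?I \<and>
    (\<forall>H. H \<subset> G \<longrightarrow> genideal (mpoly_ring n) H \<noteq> ?I)"
  define N where "N = {g. Poly_Mapping.keys g \<subseteq> {1..n} \<and> (monom g :: 'k mpoly) \<in> G}"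
  have G_eq: "G = monom ` N"
    using G by (auto simp: N_def monomials_def)
  have N: "\<forall>g\<in>N. Poly_Mapping.keys g \<subseteq> {1..n}"
    by (simp add: N_def)
  have eq: "genideal (mpoly_ring n) (monom ` N) = ?I"
    using G G_eq by blast
  have "M \<subseteq> N"
  proof
    fix g assume g: "g \<in> M"
    have "(monom g :: 'k mpoly) \<in> ?I"
      using g M by (subst monom_in_genideal_iff) auto
    then obtain h where h: "h \<in> N" "Poly_Mapping.lookup h \<le> Poly_Mapping.lookup g"
      using eq g M N monom_in_genideal_iff[of N n g] by blast
    have "(monom h :: 'k mpoly) \<in> ?I"
      unfolding eq[symmetric] using h N by (subst monom_in_genideal_iff) auto
    then obtain g' where g': "g' \<in> M" "Poly_Mapping.lookup g' \<le> Poly_Mapping.lookup h"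
      using M N h monom_in_genideal_iff[of M n h] by blast
    have "g' = g"
      using antichain[OF g'(1) g] g'(2) h(2) by (meson order_trans)
    then have "g = h"
      using g' h(2) by (metis antisym poly_mapping_eqI)
    then show "g \<in> N" using h by simp
  qed
  then have "monom ` M \<subseteq> G"
    using G_eq by blast
  then show "G = monom ` M"
    using G by blast
qed simp

section \<open>Square-free monomials\<close>

definition sqfree :: "nat set \<Rightarrow> (nat \<Rightarrow>\<^sub>0 nat)" where
  "sqfree A = (\<Sum>k\<in>A. Poly_Mapping.single k 1)"

lemma lookup_sqfree: "finite A \<Longrightarrow> Poly_Mapping.lookup (sqfree A) k = (if k \<in> A then 1 else 0)"
  by (simp add: sqfree_def lookup_sum lookup_single when_def)

lemma keys_sqfree: "finite A \<Longrightarrow> Poly_Mapping.keys (sqfree A) = A"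
  by (auto simp: in_keys_iff lookup_sqfree split: if_splits)

lemma sqfree_le_iff:
  "finite A \<Longrightarrow> Poly_Mapping.lookup (sqfree A) \<le> Poly_Mapping.lookup m \<longleftrightarrow> A \<subseteq> Poly_Mapping.keys m"
  by (auto simp: le_fun_def lookup_sqfree in_keys_iff Suc_le_eq)

lemma prod_mvar: "finite A \<Longrightarrow> (\<Prod>k\<in>A. mvar k) = monom (sqfree A)"
  by (induction A rule: finite_induct) (simp_all add: sqfree_def mvar_def mult_single)

lemma min_gens_sqfree_antichain:
  assumes E: "\<forall>e\<in>E. e \<subseteq> {1..n}"
    and antichain: "\<And>e e'. \<lbrakk>e \<in> E; e' \<in> E; e \<subseteq> e'\<rbrakk> \<Longrightarrow> e = e'"
  shows "min_gens n (genideal (mpoly_ring n) ((\<lambda>e. \<Prod>k\<in>e. mvar k) ` E :: 'k::field mpoly set)) =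
    (\<lambda>e. \<Prod>k\<in>e. mvar k) ` E"
proof -
  have fin: "finite e" if "e \<in> E" for e
    using E that by (meson finite_atLeastAtMost finite_subset)
  have img: "((\<lambda>e. \<Prod>k\<in>e. mvar k) ` E :: 'k mpoly set) = monom ` sqfree ` E"
    unfolding image_image by (rule image_cong) (simp_all add: fin prod_mvar)
  show ?thesis
    unfolding img
  proof (rule min_gens_antichain)
    show "\<forall>g\<in>sqfree ` E. Poly_Mapping.keys g \<subseteq> {1..n}"
      using E by (auto simp: keys_sqfree fin)
    show "g = h" if gh: "g \<in> sqfree ` E" "h \<in> sqfree ` E"
      "Poly_Mapping.lookup g \<le> Poly_Mapping.lookup h" for g h
    proof -
      obtain e e' where e: "e \<in> E" "g = sqfree e" "e' \<in> E" "h = sqfree e'"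
        using gh(1,2) by blast
      then have "e \<subseteq> e'"
        using gh(3) by (simp add: sqfree_le_iff keys_sqfree fin)
      then show ?thesis
        using e antichain[of e e'] by simp
    qed
  qed
qed

text \<open>
  Identifies the generators of the prime ideal that an edge contributes to the Alexander dual.
\<close>

lemma mvar_divides_prod_mvar_iff:
  assumes "A \<subseteq> {1..n}"
  shows "mvar i divides\<^bsub>mpoly_ring n\<^esub> (\<Prod>k\<in>A. mvar k :: 'k::field mpoly) \<longleftrightarrow> i \<in> A"
proof
  have fin: "finite A"
    using assms by (meson finite_atLeastAtMost finite_subset)
  assume "mvar i divides\<^bsub>mpoly_ring n\<^esub> (\<Prod>k\<in>A. mvar k :: 'k mpoly)"
  then obtain c :: "'k mpoly" where "monom (sqfree A) = mvar i * c"
    by (auto simp: factor_def mpoly_ring_ops prod_mvar[OF fin])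
  then have "sqfree A \<in> Poly_Mapping.keys (mvar i * c)"
    by (metis keys_single zero_neq_one insertI1)
  then obtain a where "sqfree A = Poly_Mapping.single i 1 + a"
    using Poly_Mapping.keys_mult[of "mvar i" c] by (auto simp: mvar_def)
  then have "Poly_Mapping.lookup (sqfree A) i \<noteq> 0"
    by (simp add: lookup_add)
  then show "i \<in> A"
    by (simp add: lookup_sqfree[OF fin] split: if_splits)
next
  assume i: "i \<in> A"
  have fin: "finite A"
    using assms by (meson finite_atLeastAtMost finite_subset)
  have "(\<Prod>k\<in>A. mvar k :: 'k mpoly) = mvar i * (\<Prod>k\<in>A - {i}. mvar k)"
    using fin i by (rule prod.remove)
  moreover have "(\<Prod>k\<in>A - {i}. mvar k :: 'k mpoly) \<in> carrier (mpoly_ring n)"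
    using fin assms by (auto simp: prod_mvar keys_sqfree mem_carrier_mpoly_ring)
  ultimately show "mvar i divides\<^bsub>mpoly_ring n\<^esub> (\<Prod>k\<in>A. mvar k :: 'k mpoly)"
    by (auto simp: factor_def mpoly_ring_ops)
qed

section \<open>Vertex covers and the Alexander dual\<close>

definition vertex_cover :: "nat set set \<Rightarrow> nat set \<Rightarrow> bool" where
  "vertex_cover E C \<longleftrightarrow> (\<forall>e\<in>E. C \<inter> e \<noteq> {})"

definition minimal_covers :: "nat set set \<Rightarrow> nat set set" where
  "minimal_covers E = {C. finite C \<and> vertex_cover E C \<and> (\<forall>D. D \<subset> C \<longrightarrow> \<not> vertex_cover E D)}"

lemma vertex_cover_contains_minimal:
  assumes "finite C" "vertex_cover E C"
  obtains D where "D \<in> minimal_covers E" "D \<subseteq> C"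
proof -
  have "\<exists>D. D \<in> minimal_covers E \<and> D \<subseteq> C"
    using assms
  proof (induction C rule: finite_psubset_induct)
    case (psubset C)
    show ?case
    proof (cases "\<exists>D. D \<subset> C \<and> vertex_cover E D")
      case True
      then obtain D where D: "D \<subset> C" "vertex_cover E D" by blast
      obtain D' where "D' \<in> minimal_covers E" "D' \<subseteq> D"
        using psubset.IH[OF D] by blast
      then show ?thesis using D(1) by blast
    next
      case False
      then have "C \<in> minimal_covers E"
        using psubset.hyps psubset.prems unfolding minimal_covers_def by blast
      then show ?thesis by blast
    qed
  qed
  then show thesis using that by blast
qed

text \<open>
  Vertices outside all edges can be removed from a cover.
\<close>

lemma minimal_cover_subset:
  assumes "C \<in> minimal_covers E" "\<Union>E \<subseteq> U"
  shows "C \<subseteq> U"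
proof -
  have "vertex_cover E (C \<inter> U)"
    using assms by (fastforce simp: minimal_covers_def vertex_cover_def)
  then show ?thesis
    using assms(1) by (auto simp: minimal_covers_def)
qed

text \<open>
  The prime ideal generated by the variables of an edge \<open>e\<close> consists of the polynomials all of whose
  terms have a support meeting \<open>e\<close>. Hence the intersection over all edges consists of the polynomials
  all of whose terms have a vertex cover as support. A finite cover contains a minimal one, so the
  minimal covers give generators of the dual, and these form an antichain.
\<close>

theorem min_gens_alexander_dual:
  assumes E: "\<forall>e\<in>E. e \<subseteq> {1..n}"
    and antichain: "\<And>e e'. \<lbrakk>e \<in> E; e' \<in> E; e \<subseteq> e'\<rbrakk> \<Longrightarrow> e = e'"
  shows "min_gens n (alexander_dual n (edge_ideal n (U, E) :: 'k::field mpoly set)) =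
    (\<lambda>C. \<Prod>k\<in>C. mvar k) ` minimal_covers E"
proof -
  let ?S = "mpoly_ring n :: 'k mpoly ring"
  have gens: "{(\<Prod>k\<in>e. mvar k) | e. e \<in> snd (U, E)} = (\<lambda>e. \<Prod>k\<in>e. mvar k :: 'k mpoly) ` E"
    by auto
  have sub: "C \<subseteq> {1..n}" if "C \<in> minimal_covers E" for C
    using that E by (intro minimal_cover_subset[of C E]) auto
  have fin: "finite C" if "C \<in> minimal_covers E" for C
    using that by (simp add: minimal_covers_def)
  have prime: "genideal ?S {mvar i | i. i \<in> {1..n} \<and> mvar i divides\<^bsub>?S\<^esub> (\<Prod>k\<in>e. mvar k)} =
      {f \<in> carrier ?S. \<forall>m\<in>Poly_Mapping.keys f. Poly_Mapping.keys m \<inter> e \<noteq> {}}"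
    if e: "e \<in> E" for e
  proof -
    have e_sub: "e \<subseteq> {1..n}"
      using E e by blast
    have vars: "{mvar i | i. i \<in> {1..n} \<and> mvar i divides\<^bsub>?S\<^esub> (\<Prod>k\<in>e. mvar k)} = mvar ` e"
      using e_sub by (fastforce simp: mvar_divides_prod_mvar_iff)
    have "genideal ?S (mvar ` e) = genideal ?S (monom ` (\<lambda>i. Poly_Mapping.single i 1) ` e)"
      by (simp add: image_image mvar_def)
    also have "\<dots> =
        {f \<in> carrier ?S. \<forall>m\<in>Poly_Mapping.keys f. \<exists>g\<in>(\<lambda>i. Poly_Mapping.single i 1) ` e.
           Poly_Mapping.lookup g \<le> Poly_Mapping.lookup m}"
      using e_sub by (intro genideal_monomials) auto
    also have "\<dots> = {f \<in> carrier ?S. \<forall>m\<in>Poly_Mapping.keys f. Poly_Mapping.keys m \<inter> e \<noteq> {}}"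
    proof -
      have "Poly_Mapping.lookup (Poly_Mapping.single i 1) \<le> Poly_Mapping.lookup m \<longleftrightarrow>
          i \<in> Poly_Mapping.keys m" for i and m :: "nat \<Rightarrow>\<^sub>0 nat"
        using sqfree_le_iff[of "{i}" m] by (simp add: sqfree_def)
      then show ?thesis by blast
    qed
    finally show ?thesis unfolding vars .
  qed
  have min_gens_edge_ideal: "min_gens n (genideal ?S ((\<lambda>e. \<Prod>k\<in>e. mvar k) ` E)) =
      (\<lambda>e. \<Prod>k\<in>e. mvar k) ` E"
    using assms by (intro min_gens_sqfree_antichain) blast+
  have "alexander_dual n (edge_ideal n (U, E)) = carrier ?S \<inter> (\<Inter>e\<in>E.
      genideal ?S {mvar i | i. i \<in> {1..n} \<and> mvar i divides\<^bsub>?S\<^esub> (\<Prod>k\<in>e. mvar k)})"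
    by (simp only: alexander_dual_def edge_ideal_def gens min_gens_edge_ideal image_image)
  also have "\<dots> = carrier ?S \<inter> (\<Inter>e\<in>E.
      {f \<in> carrier ?S. \<forall>m\<in>Poly_Mapping.keys f. Poly_Mapping.keys m \<inter> e \<noteq> {}})"
    using prime by simp
  also have "\<dots> =
      {f \<in> carrier ?S. \<forall>m\<in>Poly_Mapping.keys f. vertex_cover E (Poly_Mapping.keys m)}"
    by (auto simp: vertex_cover_def)
  also have "\<dots> = {f \<in> carrier ?S. \<forall>m\<in>Poly_Mapping.keys f.
      \<exists>g\<in>sqfree ` minimal_covers E. Poly_Mapping.lookup g \<le> Poly_Mapping.lookup m}"
  proof -
    have "vertex_cover E (Poly_Mapping.keys m) \<longleftrightarrow>
        (\<exists>g\<in>sqfree ` minimal_covers E. Poly_Mapping.lookup g \<le> Poly_Mapping.lookup m)"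
      for m :: "nat \<Rightarrow>\<^sub>0 nat"
    proof
      assume "vertex_cover E (Poly_Mapping.keys m)"
      then obtain D where "D \<in> minimal_covers E" "D \<subseteq> Poly_Mapping.keys m"
        using vertex_cover_contains_minimal[OF finite_keys] by blast
      then show "\<exists>g\<in>sqfree ` minimal_covers E. Poly_Mapping.lookup g \<le> Poly_Mapping.lookup m"
        by (auto simp: sqfree_le_iff fin)
    next
      assume "\<exists>g\<in>sqfree ` minimal_covers E. Poly_Mapping.lookup g \<le> Poly_Mapping.lookup m"
      then obtain D where "D \<in> minimal_covers E" "D \<subseteq> Poly_Mapping.keys m"
        by (auto simp: sqfree_le_iff fin)
      then show "vertex_cover E (Poly_Mapping.keys m)"
        by (fastforce simp: minimal_covers_def vertex_cover_def)
    qed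
    then show ?thesis by simp
  qed
  also have "\<dots> = genideal ?S (monom ` sqfree ` minimal_covers E)"
    using sub by (intro genideal_monomials[symmetric]) (auto simp: keys_sqfree fin)
  also have "monom ` sqfree ` minimal_covers E = (\<lambda>C. \<Prod>k\<in>C. mvar k :: 'k mpoly) ` minimal_covers E"
    unfolding image_image by (rule image_cong) (simp_all add: fin prod_mvar)
  finally have "alexander_dual n (edge_ideal n (U, E)) =
      genideal ?S ((\<lambda>C. \<Prod>k\<in>C. mvar k) ` minimal_covers E)" .
  moreover have "C = D" if "C \<in> minimal_covers E" "D \<in> minimal_covers E" "C \<subseteq> D" for C D
    using that unfolding minimal_covers_def by blast
  then have "min_gens n (genideal ?S ((\<lambda>C. \<Prod>k\<in>C. mvar k) ` minimal_covers E)) =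
      (\<lambda>C. \<Prod>k\<in>C. mvar k) ` minimal_covers E"
    using sub by (intro min_gens_sqfree_antichain) blast+
  ultimately show ?thesis
    by simp
qed

text \<open>
  The definite description in \<^const>\<open>mquot\<close> has a unique solution because polynomials have no zero
  divisors.
\<close>

lemma mquot_prod_mvar:
  assumes "A \<subseteq> {1..n}" "B \<subseteq> A"
  shows "mquot n (\<Prod>k\<in>A. mvar k) (\<Prod>k\<in>B. mvar k) = (\<Prod>k\<in>A - B. mvar k :: 'k::field mpoly)"
  unfolding mquot_def
proof (rule the_equality)
  have fin: "finite A"
    using assms by (meson finite_atLeastAtMost finite_subset)
  have factor: "(\<Prod>k\<in>A - B. mvar k) * (\<Prod>k\<in>B. mvar k) = (\<Prod>k\<in>A. mvar k :: 'k mpoly)"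
    using prod.subset_diff[OF assms(2) fin] by metis
  then show "(\<Prod>k\<in>A - B. mvar k :: 'k mpoly) \<in> carrier (mpoly_ring n) \<and>
      (\<Prod>k\<in>A - B. mvar k) * (\<Prod>k\<in>B. mvar k) = (\<Prod>k\<in>A. mvar k :: 'k mpoly)"
    using fin assms by (auto simp: prod_mvar keys_sqfree mem_carrier_mpoly_ring)
  have "(\<Prod>k\<in>B. mvar k :: 'k mpoly) \<noteq> 0"
    using finite_subset[OF assms(2) fin] by (metis prod_mvar keys_single keys_zero insert_not_empty zero_neq_one)
  then show "h = (\<Prod>k\<in>A - B. mvar k)"
    if "h \<in> carrier (mpoly_ring n) \<and> h * (\<Prod>k\<in>B. mvar k) = (\<Prod>k\<in>A. mvar k)" for h :: "'k mpoly"
    using that factor by (metis mult_right_cancel)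
qed

section \<open>Spread chains and blocks\<close>

definition spread_chain :: "nat \<Rightarrow> (nat \<Rightarrow> nat) \<Rightarrow> (nat \<Rightarrow> nat set) \<Rightarrow> (nat \<Rightarrow> nat) \<Rightarrow> bool" where
  "spread_chain d t V s \<longleftrightarrow>
     (\<forall>l\<in>{1..d}. s l \<in> V l) \<and> (\<forall>l\<in>{1..<d}. s l + t l \<le> s (Suc l))"

lemma chain_mem: "\<lbrakk>spread_chain d t V s; 1 \<le> l; l \<le> d\<rbrakk> \<Longrightarrow> s l \<in> V l"
  by (simp add: spread_chain_def)

lemma chain_step: "\<lbrakk>spread_chain d t V s; 1 \<le> l; l < d\<rbrakk> \<Longrightarrow> s l + t l \<le> s (Suc l)"
  by (simp add: spread_chain_def)

text \<open>
  Edges are parametrised by their increasing enumerations, with natural-number inequalities in place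
  of integer differences.
\<close>

lemma spread_edges_eq_chains: "spread_edges d t V = {s ` {1..d} | s. spread_chain d t V s}"
proof -
  have "(\<forall>j\<in>{2..d}. int (k j) - int (k (j - 1)) \<ge> int (t (j - 1))) \<longleftrightarrow>
      (\<forall>l\<in>{1..<d}. k l + t l \<le> k (Suc l))" for k :: "nat \<Rightarrow> nat"
  proof
    assume *: "\<forall>j\<in>{2..d}. int (k j) - int (k (j - 1)) \<ge> int (t (j - 1))"
    show "\<forall>l\<in>{1..<d}. k l + t l \<le> k (Suc l)"
    proof
      fix l assume "l \<in> {1..<d}"
      then show "k l + t l \<le> k (Suc l)" using *[rule_format, of "Suc l"] by simp
    qed
  next
    assume *: "\<forall>l\<in>{1..<d}. k l + t l \<le> k (Suc l)"
    show "\<forall>j\<in>{2..d}. int (k j) - int (k (j - 1)) \<ge> int (t (j - 1))"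
    proof
      fix j assume "j \<in> {2..d}"
      then show "int (k j) - int (k (j - 1)) \<ge> int (t (j - 1))"
        using *[rule_format, of "j - 1"] by (cases j) auto
    qed
  qed
  then show ?thesis
    by (simp add: spread_edges_def spread_chain_def)
qed

text \<open>
  The sets that turn out to be the minimal covers. Vertices below the threshold \<open>r l\<close> are blocked in
  each class from \<open>j\<close> to \<open>p - 1\<close>; in a class after the \<open>j\<close>-th one, only the vertices that an edge can
  reach after having passed the previous threshold need to be blocked. For \<open>j = p\<close> this is all of \<open>V j\<close>.
\<close>

definition block ::
    "(nat \<Rightarrow> nat) \<Rightarrow> (nat \<Rightarrow> nat set) \<Rightarrow> nat \<Rightarrow> nat \<Rightarrow> (nat \<Rightarrow> nat) \<Rightarrow> nat set" where
  "block t V j p r =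
     (\<Union>l\<in>{j..p}. {x \<in> V l. (j < l \<longrightarrow> r (l - 1) + t (l - 1) \<le> x) \<and> (l < p \<longrightarrow> x < r l)})"

lemma in_blockE:
  assumes "x \<in> block t V j p r"
  obtains l where "j \<le> l" "l \<le> p" "x \<in> V l"
    "j < l \<longrightarrow> r (l - 1) + t (l - 1) \<le> x" "l < p \<longrightarrow> x < r l"
proof -
  obtain l where "l \<in> {j..p}"
    "x \<in> {x \<in> V l. (j < l \<longrightarrow> r (l - 1) + t (l - 1) \<le> x) \<and> (l < p \<longrightarrow> x < r l)}"
    using assms unfolding block_def by blast
  then show thesis by (intro that[of l]) auto
qed

text \<open>
  A chain that avoids the block cannot start below \<open>r j\<close> in class \<open>j\<close>, and then it stays at or above
  all thresholds: having passed \<open>r l\<close>, it enters class \<open>l + 1\<close> at or above \<open>r l + t l\<close>, where everything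
  below \<open>r (l + 1)\<close> is blocked. In class \<open>p\<close> everything that it can reach is blocked.
\<close>

lemma chain_meets_block:
  assumes "spread_chain d t V s" "1 \<le> j" "j \<le> p" "p \<le> d"
  shows "\<exists>l\<in>{1..d}. s l \<in> block t V j p r"
proof (rule ccontr)
  assume "\<not> ?thesis"
  then have avoid: "s l \<notin> block t V j p r" if "1 \<le> l" "l \<le> d" for l
    using that by auto
  note mem = chain_mem[OF assms(1)] and step = chain_step[OF assms(1)]
  have above: "l < p \<longrightarrow> r l \<le> s l" if "j \<le> l" for l
    using that
  proof (induction l rule: nat_induct_at_least)
    case base
    show ?case
      using avoid[of j] mem[of j] assms by (auto simp: block_def not_less)
  next
    case (Suc l)
    show ?case
    proof (intro impI, rule ccontr)
      assume l: "Suc l < p" and "\<not> r (Suc l) \<le> s (Suc l)"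
      moreover have "r l + t l \<le> s (Suc l)"
        using Suc.IH step[of l] l Suc.hyps assms by simp
      ultimately have "s (Suc l) \<in> block t V j p r"
        using mem[of "Suc l"] Suc.hyps assms by (auto simp: block_def intro!: bexI[of _ "Suc l"])
      then show False
        using avoid[of "Suc l"] l assms by simp
    qed
  qed
  have "r (p - 1) + t (p - 1) \<le> s p" if "j < p"
  proof -
    have "j \<le> p - 1" "1 \<le> p - 1" "p - 1 < d" "Suc (p - 1) = p"
      using that assms by auto
    then show ?thesis
      using above[of "p - 1"] step[of "p - 1"] by simp
  qed
  then have "s p \<in> block t V j p r"
    using mem[of p] assms by (auto simp: block_def intro!: bexI[of _ p])
  then show False
    using avoid[of p] assms by simp
qed

section \<open>Minimal covers for interval classes\<close>

text \<open>
  The absence of isolated vertices enters as \<open>chain_through\<close>: every vertex of every class lies on a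
  chain. It is used to extend partial chains to whole edges, and to compare the ends of consecutive
  intervals.
\<close>

locale interval_spread =
  fixes d :: nat and t a b :: "nat \<Rightarrow> nat" and V :: "nat \<Rightarrow> nat set"
  assumes interval: "\<And>l. \<lbrakk>1 \<le> l; l \<le> d\<rbrakk> \<Longrightarrow> V l = {a l..b l}"
    and nonempty: "\<And>l. \<lbrakk>1 \<le> l; l \<le> d\<rbrakk> \<Longrightarrow> a l \<le> b l"
    and separated: "\<And>l l'. \<lbrakk>1 \<le> l; l < l'; l' \<le> d\<rbrakk> \<Longrightarrow> b l < a l'"
    and chain_through: "\<And>l x. \<lbrakk>1 \<le> l; l \<le> d; x \<in> V l\<rbrakk> \<Longrightarrow> \<exists>s. spread_chain d t V s \<and> s l = x"
begin

lemma mem_unique: "\<lbrakk>x \<in> V l; x \<in> V l'; 1 \<le> l; l \<le> d; 1 \<le> l'; l' \<le> d\<rbrakk> \<Longrightarrow> l = l'"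
  using separated[of l l'] separated[of l' l] interval[of l] interval[of l']
  by (cases l l' rule: linorder_cases) auto

text \<open>
  Follow a chain through the first vertex of class \<open>l + 1\<close> back into class \<open>l\<close>. The dual argument
  with the last vertex of class \<open>l\<close> gives \<open>right_ends\<close>.
\<close>

lemma left_ends: "\<lbrakk>1 \<le> l; l < d\<rbrakk> \<Longrightarrow> a l + t l \<le> a (Suc l)"
proof -
  assume l: "1 \<le> l" "l < d"
  obtain s where s: "spread_chain d t V s" "s (Suc l) = a (Suc l)"
    using chain_through[of "Suc l" "a (Suc l)"] interval[of "Suc l"] nonempty[of "Suc l"] l by auto
  show ?thesis
    using chain_mem[OF s(1), of l] chain_step[OF s(1) l] s(2) interval[of l] l by simp
qed

lemma right_ends: "\<lbrakk>1 \<le> l; l < d\<rbrakk> \<Longrightarrow> b l + t l \<le> b (Suc l)"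
proof -
  assume l: "1 \<le> l" "l < d"
  obtain s where s: "spread_chain d t V s" "s l = b l"
    using chain_through[of l "b l"] interval[of l] nonempty[of l] l by auto
  show ?thesis
    using chain_mem[OF s(1), of "Suc l"] chain_step[OF s(1) l] s(2) interval[of "Suc l"] l by simp
qed

text \<open>
  All edges have cardinality \<open>d\<close>, because the classes are disjoint.
\<close>

lemma edges_antichain:
  assumes "e \<in> spread_edges d t V" "e' \<in> spread_edges d t V" "e \<subseteq> e'"
  shows "e = e'"
proof -
  have "card f = d \<and> finite f" if f: "f \<in> spread_edges d t V" for f
  proof -
    obtain s where s: "f = s ` {1..d}" "spread_chain d t V s"
      using f unfolding spread_edges_eq_chains by blast
    have "inj_on s {1..d}"
    proof (rule inj_onI)
      fix l l' assume "l \<in> {1..d}" "l' \<in> {1..d}" "s l = s l'"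
      then show "l = l'"
        using chain_mem[OF s(2), of l] chain_mem[OF s(2), of l'] mem_unique[of "s l" l l'] by auto
    qed
    then show ?thesis by (simp add: s card_image)
  qed
  then show ?thesis
    using assms by (metis card_subset_eq)
qed

text \<open>
  The last two conditions select, for each block, thresholds for which it is irredundant: consecutive
  thresholds are themselves compatible with the spread, and each class after the \<open>j\<close>-th one really
  loses its first vertex. Without the latter, the block starting at the class in question would
  already be a cover.
\<close>

definition valid_block :: "nat \<Rightarrow> nat \<Rightarrow> (nat \<Rightarrow> nat) \<Rightarrow> bool" where
  "valid_block j p r \<longleftrightarrow> 1 \<le> j \<and> j \<le> p \<and> p \<le> d \<and> (\<forall>l\<in>{j..<p}. r l \<in> V l) \<and>
     (\<forall>l\<in>{j<..<p}. r (l - 1) + t (l - 1) \<le> r l) \<and> (\<forall>l\<in>{j<..p}. a l < r (l - 1) + t (l - 1))"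

lemma mem_block_iff:
  assumes "x \<in> V l" "1 \<le> l" "l \<le> d" "1 \<le> j" "p \<le> d"
  shows "x \<in> block t V j p r \<longleftrightarrow>
    j \<le> l \<and> l \<le> p \<and> (j < l \<longrightarrow> r (l - 1) + t (l - 1) \<le> x) \<and> (l < p \<longrightarrow> x < r l)"
proof
  assume "x \<in> block t V j p r"
  then obtain l' where l': "j \<le> l'" "l' \<le> p" "x \<in> V l'"
    "j < l' \<longrightarrow> r (l' - 1) + t (l' - 1) \<le> x" "l' < p \<longrightarrow> x < r l'"
    by (rule in_blockE)
  then have "l' = l"
    using assms mem_unique[of x l' l] by auto
  then show "j \<le> l \<and> l \<le> p \<and> (j < l \<longrightarrow> r (l - 1) + t (l - 1) \<le> x) \<and> (l < p \<longrightarrow> x < r l)"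
    using l' by auto
next
  assume "j \<le> l \<and> l \<le> p \<and> (j < l \<longrightarrow> r (l - 1) + t (l - 1) \<le> x) \<and> (l < p \<longrightarrow> x < r l)"
  then show "x \<in> block t V j p r"
    unfolding block_def using assms(1) by (intro UN_I[of l]) auto
qed

text \<open>
  Minimality of a block. Given \<open>x\<close> in class \<open>h\<close> of the block, run along the thresholds \<open>r l\<close> before
  class \<open>h\<close>, pass through \<open>x\<close>, and then, in each later class up to \<open>p\<close>, take the largest vertex that
  the block leaves free at the left end, namely \<open>r (l - 1) + t (l - 1) - 1\<close>. The latter exists in
  \<open>V l\<close> because \<open>V l\<close> is an interval. Outside the classes \<open>j, \<dots>, p\<close> the block is empty, so this partial chain can be
  prolonged in both directions by chains through its two ends.
\<close>

lemma block_critical: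
  assumes valid: "valid_block j p r" and x: "x \<in> block t V j p r"
  obtains s where "spread_chain d t V s" "\<And>l. \<lbrakk>1 \<le> l; l \<le> d; s l \<in> block t V j p r\<rbrakk> \<Longrightarrow> s l = x"
proof -
  have jp: "1 \<le> j" "j \<le> p" "p \<le> d"
    and r_mem: "\<And>l. \<lbrakk>j \<le> l; l < p\<rbrakk> \<Longrightarrow> r l \<in> V l"
    and r_step: "\<And>l. \<lbrakk>j < l; l < p\<rbrakk> \<Longrightarrow> r (l - 1) + t (l - 1) \<le> r l"
    and r_left: "\<And>l. \<lbrakk>j < l; l \<le> p\<rbrakk> \<Longrightarrow> a l < r (l - 1) + t (l - 1)"
    using valid by (auto simp: valid_block_def)
  obtain h where h: "j \<le> h" "h \<le> p" "x \<in> V h"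
    "j < h \<longrightarrow> r (h - 1) + t (h - 1) \<le> x" "h < p \<longrightarrow> x < r h"
    using x by (rule in_blockE)
  \<comment> \<open>The part of the chain in the classes \<open>j, \<dots>, p\<close>; it meets the block only in \<open>x\<close>.\<close>
  define c where "c l = (if l < h then r l else if l = h then x else r (l - 1) + t (l - 1) - 1)" for l
  have c_mem: "c l \<in> V l" if l: "j \<le> l" "l \<le> p" for l
  proof (cases "h < l")
    case True
    then have "r (l - 1) \<le> b (l - 1)"
      using r_mem[of "l - 1"] interval[of "l - 1"] h l jp by auto
    moreover have "b (l - 1) + t (l - 1) \<le> b l"
      using right_ends[of "l - 1"] True h l jp by simp
    moreover have "a l < r (l - 1) + t (l - 1)"
      using r_left[of l] True h l by simp
    ultimately have "a l \<le> r (l - 1) + t (l - 1) - 1" "r (l - 1) + t (l - 1) - 1 \<le> b l"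
      by linarith+
    then show ?thesis
      using True interval[of l] l jp by (simp add: c_def)
  next
    case False
    then show ?thesis using r_mem[of l] h l by (auto simp: c_def)
  qed
  have c_step: "c l + t l \<le> c (Suc l)" if l: "j \<le> l" "l < p" for l
  proof -
    consider "Suc l < h" | "Suc l = h" | "l = h" | "h < l" by linarith
    then show ?thesis
    proof cases
      case 1 then show ?thesis using r_step[of "Suc l"] h l by (simp add: c_def)
    next
      case 2 then show ?thesis using h l by (auto simp: c_def)
    next
      case 3 then show ?thesis using h l by (simp add: c_def)
    next
      case 4 then show ?thesis using r_step[of l] r_left[of l] h l by (simp add: c_def)
    qed
  qed
  have c_avoid: "c l \<notin> block t V j p r" if l: "j \<le> l" "l \<le> p" "l \<noteq> h" for l
  proof (cases "l < h")
    case True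
    then show ?thesis
      using mem_block_iff[OF c_mem[OF l(1,2)], of j p r] h l jp by (simp add: c_def)
  next
    case False
    then have "h < l" "j < l"
      using h l by simp_all
    then have "c l < r (l - 1) + t (l - 1)"
      using r_left[of l] l by (simp add: c_def)
    then show ?thesis
      using mem_block_iff[OF c_mem[OF l(1,2)], of j p r] \<open>j < l\<close> l jp by simp
  qed
  obtain u where u: "spread_chain d t V u" "u j = c j"
    using chain_through[of j "c j"] c_mem[of j] jp by auto
  obtain w where w: "spread_chain d t V w" "w p = c p"
    using chain_through[of p "c p"] c_mem[of p] jp by auto
  define s where "s l = (if l < j then u l else if l \<le> p then c l else w l)" for l
  have s_mem: "s l \<in> V l" if "1 \<le> l" "l \<le> d" for l
    using that u(1) w(1) c_mem[of l] by (auto simp: s_def spread_chain_def)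
  have s_step: "s l + t l \<le> s (Suc l)" if l: "1 \<le> l" "l < d" for l
  proof -
    have u_step: "u l + t l \<le> u (Suc l)" and w_step: "w l + t l \<le> w (Suc l)"
      using u(1) w(1) l by (auto simp: spread_chain_def)
    consider "Suc l < j" | "Suc l = j" | "j \<le> l" "l < p" | "l = p" | "p < l" by linarith
    then show ?thesis
    proof cases
      case 1 then show ?thesis using u_step by (simp add: s_def)
    next
      case 2 then show ?thesis using u_step u(2) jp by (auto simp: s_def)
    next
      case 3 then show ?thesis using c_step by (simp add: s_def)
    next
      case 4 then show ?thesis using w_step w(2) jp by (simp add: s_def)
    next
      case 5 then show ?thesis using w_step jp by (simp add: s_def)
    qed
  qed
  show thesis
  proof (rule that)
    show "spread_chain d t V s"
      using s_mem s_step by (auto simp: spread_chain_def)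
    fix l assume l: "1 \<le> l" "l \<le> d" "s l \<in> block t V j p r"
    then have "j \<le> l" "l \<le> p"
      using mem_block_iff[OF s_mem[OF l(1,2)], of j p r] jp by auto
    then show "s l = x"
      using l(3) c_avoid[of l] by (cases "l = h") (auto simp: s_def c_def)
  qed
qed

text \<open>
  Build a chain avoiding the cover \<open>C\<close> greedily, always choosing the smallest possible vertex. As \<open>C\<close>
  is a cover, this gets stuck on entering some class \<open>p\<close>. By the greedy choice, all reachable vertices
  below the chosen ones lie in \<open>C\<close>, and so do all reachable vertices of class \<open>p\<close>. Let \<open>j\<close> be the last
  class up to \<open>p\<close> whose first vertex is reachable from the vertex chosen before (or the first class): from there
  on, the vertices that were found to lie in \<open>C\<close> form a valid block.
\<close>

lemma cover_contains_block:
  assumes cover: "\<And>s. spread_chain d t V s \<Longrightarrow> \<exists>l\<in>{1..d}. s l \<in> C"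
  obtains j p r where "valid_block j p r" "block t V j p r \<subseteq> C"
proof -
  \<comment> \<open>The first \<open>p\<close> steps of the greedy construction, with thresholds \<open>r 1, \<dots>, r p\<close>.\<close>
  define greedy where "greedy p r \<longleftrightarrow>
      (\<forall>l\<in>{1..p}. r l \<in> V l - C) \<and> (\<forall>l\<in>{1..<p}. r l + t l \<le> r (Suc l)) \<and>
      (\<forall>l\<in>{1..p}. \<forall>x\<in>V l. x < r l \<and> (1 < l \<longrightarrow> r (l - 1) + t (l - 1) \<le> x) \<longrightarrow> x \<in> C)"
    for p and r :: "nat \<Rightarrow> nat"
  have "\<not> greedy d r" for r
    using cover[of r] by (auto simp: greedy_def spread_chain_def)
  moreover have "greedy 0 r" for r
    by (simp add: greedy_def)
  ultimately obtain p0 where p0: "p0 < d" "\<exists>r. greedy p0 r" "\<not> (\<exists>r. greedy (Suc p0) r)"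
    using ex_least_nat_less[of "\<lambda>p. \<not> (\<exists>r. greedy p r)" d] by auto
  then obtain r where r: "greedy p0 r" by blast
  have r_mem: "r l \<in> V l" if "1 \<le> l" "l \<le> p0" for l
    using r that by (auto simp: greedy_def)
  have r_step: "r l + t l \<le> r (Suc l)" if "1 \<le> l" "l < p0" for l
    using r that by (auto simp: greedy_def)
  define p where "p = Suc p0"
  \<comment> \<open>For \<open>l = p\<close>: a reachable vertex outside \<open>C\<close> would allow one more greedy step.\<close>
  have below: "x \<in> C"
    if "1 \<le> l" "l \<le> p" "x \<in> V l" "l < p \<longrightarrow> x < r l" "1 < l \<longrightarrow> r (l - 1) + t (l - 1) \<le> x" for l x
  proof (cases "l = p")
    case False
    then show ?thesis using r that by (auto simp: greedy_def p_def)
  next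
    case True
    show ?thesis
    proof (rule ccontr)
      assume "x \<notin> C"
      let ?P = "\<lambda>y. y \<in> V p - C \<and> (1 < p \<longrightarrow> r p0 + t p0 \<le> y)"
      define y where "y = (LEAST y. ?P y)"
      have "?P x" using that True \<open>x \<notin> C\<close> by (auto simp: p_def)
      then have y: "?P y" unfolding y_def by (rule LeastI)
      have y_least: "z \<in> C" if "z \<in> V p" "z < y" "1 < p \<longrightarrow> r p0 + t p0 \<le> z" for z
        using not_less_Least[of z ?P] that unfolding y_def by blast
      have "greedy (Suc p0) (r(p := y))"
        unfolding greedy_def
      proof (intro conjI ballI impI)
        fix l assume l: "l \<in> {1..Suc p0}"
        show "(r(p := y)) l \<in> V l - C"
          using r y l by (auto simp: greedy_def p_def le_Suc_eq)
        fix z assume z: "z \<in> V l"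
          "z < (r(p := y)) l \<and> (1 < l \<longrightarrow> (r(p := y)) (l - 1) + t (l - 1) \<le> z)"
        have "l - 1 \<noteq> p" using l by (auto simp: p_def)
        then show "z \<in> C"
          using r y_least[of z] l z by (cases "l = p") (auto simp: greedy_def p_def le_Suc_eq)
      next
        fix l assume "l \<in> {1..<Suc p0}"
        then show "(r(p := y)) l + t l \<le> (r(p := y)) (Suc l)"
          using r_step[of l] y by (cases "l = p0") (auto simp: p_def)
      qed
      then show False using p0(3) by blast
    qed
  qed
  define J where "J = {l \<in> {1..p}. l = 1 \<or> r (l - 1) + t (l - 1) \<le> a l}"
  define j where "j = Max J"
  have J: "finite J" "1 \<in> J"
    by (auto simp: J_def p_def)
  have "j \<in> J"
    unfolding j_def using J by (intro Max_in) auto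
  then have j: "1 \<le> j" "j \<le> p" "1 < j \<Longrightarrow> r (j - 1) + t (j - 1) \<le> a j"
    by (auto simp: J_def)
  have after_j: "a l < r (l - 1) + t (l - 1)" if "j < l" "l \<le> p" for l
  proof (rule ccontr)
    assume "\<not> ?thesis"
    then have "l \<in> J" using that j by (auto simp: J_def)
    then show False using Max_ge[OF J(1), of l] that by (simp add: j_def)
  qed
  show thesis
  proof (rule that)
    have "r (l - 1) + t (l - 1) \<le> r l" if "j < l" "l < p" for l
      using r_step[of "l - 1"] that j by (simp add: p_def)
    then show "valid_block j p r"
      using j p0(1) r_mem after_j by (auto simp: valid_block_def p_def)
    show "block t V j p r \<subseteq> C"
    proof
      fix x assume "x \<in> block t V j p r"
      then obtain l where l: "j \<le> l" "l \<le> p" "x \<in> V l"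
        "j < l \<longrightarrow> r (l - 1) + t (l - 1) \<le> x" "l < p \<longrightarrow> x < r l"
        by (rule in_blockE)
      have "1 < l \<longrightarrow> r (l - 1) + t (l - 1) \<le> x"
      proof (cases "l = j")
        case True
        have "a j \<le> x" using l(3) True interval[of j] j p0(1) by (simp add: p_def)
        then show ?thesis using True j(3) by auto
      next
        case False
        then show ?thesis using l by simp
      qed
      then show "x \<in> C"
        using below[of l x] l j by simp
    qed
  qed
qed

text \<open>
  Every cover contains a block, blocks are covers, and by \<open>block_critical\<close> no proper subset of a
  block is a cover.
\<close>

theorem minimal_covers_eq_blocks:
  "minimal_covers (spread_edges d t V) = {block t V j p r | j p r. valid_block j p r}"
proof -
  have cover_iff: "vertex_cover (spread_edges d t V) C \<longleftrightarrow>
      (\<forall>s. spread_chain d t V s \<longrightarrow> (\<exists>l\<in>{1..d}. s l \<in> C))" for C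
    by (auto simp: vertex_cover_def spread_edges_eq_chains)
  have block_cover: "vertex_cover (spread_edges d t V) (block t V j p r)" if "valid_block j p r" for j p r
    unfolding cover_iff using that chain_meets_block by (simp add: valid_block_def)
  have block_finite: "finite (block t V j p r)" if "valid_block j p r" for j p r
    using that interval by (auto simp: block_def valid_block_def)
  show ?thesis
  proof (intro equalityI subsetI)
    fix C assume C: "C \<in> minimal_covers (spread_edges d t V)"
    then have "\<And>s. spread_chain d t V s \<Longrightarrow> \<exists>l\<in>{1..d}. s l \<in> C"
      unfolding minimal_covers_def cover_iff by blast
    then obtain j p r where jpr: "valid_block j p r" "block t V j p r \<subseteq> C"
      by (rule cover_contains_block)
    then have "block t V j p r = C"
      using C block_cover[OF jpr(1)] unfolding minimal_covers_def by blast
    then show "C \<in> {block t V j p r | j p r. valid_block j p r}"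
      using jpr(1) by blast
  next
    fix C assume "C \<in> {block t V j p r | j p r. valid_block j p r}"
    then obtain j p r where jpr: "valid_block j p r" "C = block t V j p r" by blast
    have "\<not> vertex_cover (spread_edges d t V) D" if D: "D \<subset> C" for D
    proof
      assume cover: "vertex_cover (spread_edges d t V) D"
      obtain x where x: "x \<in> C" "x \<notin> D" using D by blast
      obtain s where s: "spread_chain d t V s"
          "\<And>l. \<lbrakk>1 \<le> l; l \<le> d; s l \<in> block t V j p r\<rbrakk> \<Longrightarrow> s l = x"
        using block_critical[OF jpr(1), of x] x jpr(2) by blast
      obtain l where l: "l \<in> {1..d}" "s l \<in> D"
        using cover s(1) by (auto simp: cover_iff)
      then have "s l = x" using s(2)[of l] D jpr(2) by auto
      then show False using l x by simp
    qed
    then show "C \<in> minimal_covers (spread_edges d t V)"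
      using block_cover[OF jpr(1)] block_finite[OF jpr(1)] jpr(2) by (simp add: minimal_covers_def)
  qed
qed

end

section \<open>From blocks to monomial quotients\<close>

text \<open>
  The bound on \<open>q l\<close> keeps the truncated differences in \<^const>\<open>vlast\<close> from collapsing.
\<close>

lemma vlast_eq_prod_interval:
  assumes "q l < i l + m l"
  shows "vlast i m q l = (\<Prod>k\<in>{i l + m l - 1 - q l..i l + m l - 1}. mvar k)"
  unfolding vlast_def
  by (rule prod.reindex_bij_witness[of _ "\<lambda>k. i l + m l - k" "\<lambda>r. i l + m l - r"])
    (use assms in auto)

lemma vfirst_eq_prod_interval: "vfirst i q' l = (\<Prod>k\<in>{i l..i l + q' l}. mvar k)"
  unfolding vfirst_def
  by (rule prod.reindex_bij_witness[of _ "\<lambda>k. k - i l" "\<lambda>r. i l + r"]) auto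

lemma block_cong:
  assumes "\<And>l. \<lbrakk>j \<le> l; l < p\<rbrakk> \<Longrightarrow> r l = r' l"
  shows "block t V j p r = block t V j p r'"
  unfolding block_def
proof (intro SUP_cong refl Collect_cong)
  fix l x assume l: "l \<in> {j..p}"
  have "r (l - 1) = r' (l - 1)" if "j < l"
    using assms[of "l - 1"] l that by auto
  moreover have "r l = r' l" if "l < p"
    using assms[of l] l that by auto
  ultimately show "x \<in> V l \<and> (j < l \<longrightarrow> r (l - 1) + t (l - 1) \<le> x) \<and> (l < p \<longrightarrow> x < r l) \<longleftrightarrow>
      x \<in> V l \<and> (j < l \<longrightarrow> r' (l - 1) + t (l - 1) \<le> x) \<and> (l < p \<longrightarrow> x < r' l)"
    by auto
qed

context interval_spread
begin

lemma disjoint_parts: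
  assumes "1 \<le> l" "l \<le> d" "1 \<le> l'" "l' \<le> d" "l \<noteq> l'"
  shows "V l \<inter> V l' = {}"
proof -
  have "x \<notin> V l'" if "x \<in> V l" for x
    using mem_unique[of x l l'] that assms by blast
  then show ?thesis by blast
qed

lemma valid_block_memD: "\<lbrakk>valid_block j p r; j \<le> l; l < p\<rbrakk> \<Longrightarrow> a l \<le> r l \<and> r l \<le> b l"
  using interval[of l] by (auto simp: valid_block_def)

lemma valid_block_stepD:
  "\<lbrakk>valid_block j p r; j < l; l < p\<rbrakk> \<Longrightarrow> r (l - 1) + t (l - 1) \<le> r l"
  by (simp add: valid_block_def)

lemma valid_block_leftD:
  "\<lbrakk>valid_block j p r; j < l; l \<le> p\<rbrakk> \<Longrightarrow> a l < r (l - 1) + t (l - 1)"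
  by (simp add: valid_block_def)

lemma valid_block_rightD:
  assumes "valid_block j p r" "j < l" "l \<le> p"
  shows "r (l - 1) + t (l - 1) \<le> b l"
proof -
  have "1 \<le> l - 1" "l - 1 < d" "Suc (l - 1) = l" "j \<le> l - 1" "l - 1 < p"
    using assms by (auto simp: valid_block_def)
  then show ?thesis
    using right_ends[of "l - 1"] valid_block_memD[OF assms(1), of "l - 1"] by simp
qed

lemma valid_block_right_part:
  assumes "valid_block j p r" "j \<le> l" "l < p"
  shows "{r l..b l} \<subseteq> V l"
proof -
  have "V l = {a l..b l}"
    using assms by (intro interval) (auto simp: valid_block_def)
  then show ?thesis
    using valid_block_memD[OF assms] by simp
qed

lemma valid_block_left_part:
  assumes "valid_block j p r" "j < l" "l \<le> p"
  shows "{a l..<r (l - 1) + t (l - 1)} \<subseteq> V l"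
proof -
  have "V l = {a l..b l}"
    using assms by (intro interval) (auto simp: valid_block_def)
  then show ?thesis
    using valid_block_rightD[OF assms] by (simp add: subset_iff)
qed

text \<open>
  The thresholds are the first vertices of the removed final segments, \<open>r l = b l - q l\<close>; the equations
  in \<^const>\<open>admissible\<close> then say that the removed initial segment of class \<open>l + 1\<close> ends at
  \<open>r l + t l - 1\<close>. That \<open>q j\<close> is smaller than the length of class \<open>j\<close> is not among the admissibility
  conditions: it follows from \<open>left_ends\<close>, that is, from the absence of isolated vertices.
\<close>

lemma admissible_imp_valid_block:
  assumes m: "\<And>l. \<lbrakk>1 \<le> l; l \<le> d\<rbrakk> \<Longrightarrow> a l + m l = Suc (b l)"
    and jp: "1 \<le> j" "j < p" "p \<le> d"
    and adm: "admissible t a m j p q q'"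
  shows "valid_block j p (\<lambda>l. b l - q l)"
    and "\<And>l. \<lbrakk>j \<le> l; l < p\<rbrakk> \<Longrightarrow> q l < b l"
    and "\<And>l. \<lbrakk>j < l; l \<le> p\<rbrakk> \<Longrightarrow> b (l - 1) - q (l - 1) + t (l - 1) = Suc (a l + q' l)"
proof -
  \<comment> \<open>The \<open>l\<close>-th link: the removed final segment of class \<open>l\<close> determines the next initial segment.\<close>
  have room: "a l + q l < b l" and link: "b l - q l + t l = Suc (a (Suc l) + q' (Suc l))"
    if l: "j \<le> l" "l < p" for l
  proof -
    have "int (a (Suc l)) + int (q' (Suc l)) - (int (a l) + int (m l) - 1 - int (q l)) = int (t l) - 1"
      using adm[unfolded admissible_def, THEN conjunct2, rule_format, of "Suc l"] l by simp
    moreover have "int (a l) + int (m l) = int (b l) + 1"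
      using m[of l] l jp by simp
    ultimately have "int (a (Suc l)) + int (q' (Suc l)) + int (q l) + 1 = int (b l) + int (t l)"
      by simp
    then have eq: "a (Suc l) + q' (Suc l) + q l + 1 = b l + t l"
      by linarith
    moreover have "a l + t l \<le> a (Suc l)"
      using left_ends[of l] l jp by simp
    ultimately show room: "a l + q l < b l"
      by linarith
    show "b l - q l + t l = Suc (a (Suc l) + q' (Suc l))"
      using eq room by linarith
  qed
  show link': "b (l - 1) - q (l - 1) + t (l - 1) = Suc (a l + q' l)" if l: "j < l" "l \<le> p" for l
    using link[of "l - 1"] l by (cases l) auto
  show "q l < b l" if "j \<le> l" "l < p" for l
    using room[OF that] by simp
  have "b (l - 1) - q (l - 1) + t (l - 1) \<le> b l - q l" if l: "j < l" "l < p" for l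
  proof -
    have "int (a l) + int (q' l) < int (a l) + int (m l) - 1 - int (q l)"
      using adm[unfolded admissible_def, THEN conjunct1, rule_format, of l] l by simp
    then have "a l + q' l + q l < b l"
      using m[of l] l jp by simp
    then show ?thesis
      using link'[of l] l by simp
  qed
  moreover have "b l - q l \<in> V l" if "j \<le> l" "l < p" for l
    using room[OF that] interval[of l] that jp by simp
  ultimately show "valid_block j p (\<lambda>l. b l - q l)"
    using jp link' by (auto simp: valid_block_def)
qed

lemma valid_block_imp_admissible:
  assumes m: "\<And>l. \<lbrakk>1 \<le> l; l \<le> d\<rbrakk> \<Longrightarrow> a l + m l = Suc (b l)"
    and valid: "valid_block j p r"
  shows "admissible t a m j p (\<lambda>l. b l - r l) (\<lambda>l. r (l - 1) + t (l - 1) - 1 - a l)"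
  unfolding admissible_def
proof (intro conjI ballI)
  have jp: "1 \<le> j" "p \<le> d" using valid by (auto simp: valid_block_def)
  fix l assume l: "l \<in> {j + 1..p - 1}"
  have "a l < r (l - 1) + t (l - 1)" "r (l - 1) + t (l - 1) \<le> r l" "r l \<le> b l"
    using valid_block_leftD[OF valid, of l] valid_block_stepD[OF valid, of l]
      valid_block_memD[OF valid, of l] l by auto
  moreover have "a l + m l = Suc (b l)"
    using m[of l] l jp by auto
  ultimately show "int (a l) + int (r (l - 1) + t (l - 1) - 1 - a l)
      < int (a l) + int (m l) - 1 - int (b l - r l)"
    by linarith
next
  have jp: "1 \<le> j" "p \<le> d" using valid by (auto simp: valid_block_def)
  fix l assume l: "l \<in> {j + 1..p}"
  have "a l < r (l - 1) + t (l - 1)"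
    using valid_block_leftD[OF valid, of l] l by auto
  moreover have "r (l - 1) \<le> b (l - 1)" 
    using valid_block_memD[OF valid, of "l - 1"] l by auto
  moreover have "a (l - 1) + m (l - 1) = Suc (b (l - 1))"
    using l jp by (intro m) auto
  ultimately show "int (a l) + int (r (l - 1) + t (l - 1) - 1 - a l) -
      (int (a (l - 1)) + int (m (l - 1)) - 1 - int (b (l - 1) - r (l - 1))) = int (t (l - 1)) - 1"
    by linarith
qed

text \<open>
  Complementing within the classes \<open>j, \<dots>, p\<close>: what a block omits is a final segment of each class but
  the last and an initial segment of each class but the first. These are the index sets of the
  factors \<^const>\<open>vlast\<close> and \<^const>\<open>vfirst\<close>.
\<close>

lemma block_eq_Diff:
  assumes valid: "valid_block j p r"
  shows "block t V j p r =
    (\<Union>l\<in>{j..p}. V l) -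
      ((\<Union>l\<in>{j..<p}. {r l..b l}) \<union> (\<Union>l\<in>{j<..p}. {a l..<r (l - 1) + t (l - 1)}))"
    (is "_ = ?U - (?R \<union> ?L)")
proof -
  have jp: "1 \<le> j" "j \<le> p" "p \<le> d" using valid by (auto simp: valid_block_def)
  have mem_iff: "x \<in> block t V j p r \<longleftrightarrow> x \<notin> ?R \<union> ?L" if l: "j \<le> l" "l \<le> p" "x \<in> V l" for l x
  proof -
    have V: "V l' = {a l'..b l'}" if "j \<le> l'" "l' \<le> p" for l'
      using interval[of l'] that jp by simp
    have uniq: "l' = l" if "j \<le> l'" "l' \<le> p" "x \<in> {a l'..b l'}" for l'
      using mem_unique[of x l' l] that V[of l'] l jp by simp
    have "x \<in> ?R \<longleftrightarrow> l < p \<and> r l \<le> x"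
    proof
      assume "x \<in> ?R"
      then obtain l' where l': "j \<le> l'" "l' < p" "r l' \<le> x" "x \<le> b l'" by auto
      then have "l' = l"
        using uniq[of l'] valid_block_memD[OF valid, of l'] by simp
      then show "l < p \<and> r l \<le> x" using l' by simp
    next
      assume "l < p \<and> r l \<le> x"
      then show "x \<in> ?R" using l V[of l] by auto
    qed
    moreover have "x \<in> ?L \<longleftrightarrow> j < l \<and> x < r (l - 1) + t (l - 1)"
    proof
      assume "x \<in> ?L"
      then obtain l' where l': "j < l'" "l' \<le> p" "a l' \<le> x" "x < r (l' - 1) + t (l' - 1)" by auto
      then have "l' = l"
        using uniq[of l'] valid_block_rightD[OF valid, of l'] by simp
      then show "j < l \<and> x < r (l - 1) + t (l - 1)" using l' by simp
    next
      assume "j < l \<and> x < r (l - 1) + t (l - 1)"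
      then show "x \<in> ?L" using l V[of l] by (intro UN_I[of l]) auto
    qed
    ultimately show ?thesis
      using mem_block_iff[of x l j p r] l jp by auto
  qed
  show ?thesis
  proof (intro equalityI subsetI)
    fix x assume x: "x \<in> block t V j p r"
    then obtain l where "j \<le> l" "l \<le> p" "x \<in> V l" by (rule in_blockE)
    then show "x \<in> ?U - (?R \<union> ?L)" using mem_iff[of l x] x by auto
  next
    fix x assume x: "x \<in> ?U - (?R \<union> ?L)"
    then obtain l where "j \<le> l" "l \<le> p" "x \<in> V l" by auto
    then show "x \<in> block t V j p r" using mem_iff[of l x] x by blast
  qed
qed

text \<open>
  The removed segments are pairwise disjoint; within one class this is the condition
  \<open>r (l - 1) + t (l - 1) \<le> r l\<close> on consecutive thresholds. So the denominator of the quotient is again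
  square-free.
\<close>

lemma prod_removed_variables:
  fixes f :: "nat \<Rightarrow> 'c::comm_monoid_mult"
  assumes valid: "valid_block j p r"
  shows "(\<Prod>l\<in>{j..<p}. \<Prod>k\<in>{r l..b l}. f k) *
      (\<Prod>l\<in>{j<..p}. \<Prod>k\<in>{a l..<r (l - 1) + t (l - 1)}. f k) =
    (\<Prod>k\<in>(\<Union>l\<in>{j..<p}. {r l..b l}) \<union> (\<Union>l\<in>{j<..p}. {a l..<r (l - 1) + t (l - 1)}). f k)"
    (is "_ = (\<Prod>k\<in>?R \<union> ?L. f k)")
proof -
  have jp: "1 \<le> j" "j \<le> p" "p \<le> d" using valid by (auto simp: valid_block_def)
  have R_sub: "{r l..b l} \<subseteq> V l" if "j \<le> l" "l < p" for l
    using valid that by (rule valid_block_right_part)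
  have L_sub: "{a l..<r (l - 1) + t (l - 1)} \<subseteq> V l" if "j < l" "l \<le> p" for l
    using valid that by (rule valid_block_left_part)
  have disj: "V l \<inter> V l' = {}" if "j \<le> l" "l \<le> p" "j \<le> l'" "l' \<le> p" "l \<noteq> l'" for l l'
    using that jp by (intro disjoint_parts) simp_all
  have sub_disj: "A \<inter> B = {}" if "A \<subseteq> V l" "B \<subseteq> V l'" "V l \<inter> V l' = {}" for A B l l'
    using that by blast
  have R_disj: "{r l..b l} \<inter> {r l'..b l'} = {}"
    if "j \<le> l" "l < p" "j \<le> l'" "l' < p" "l \<noteq> l'" for l l'
    using that by (intro sub_disj[OF R_sub R_sub disj]) simp_all
  have L_disj: "{a l..<r (l - 1) + t (l - 1)} \<inter> {a l'..<r (l' - 1) + t (l' - 1)} = {}"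
    if "j < l" "l \<le> p" "j < l'" "l' \<le> p" "l \<noteq> l'" for l l'
    using that by (intro sub_disj[OF L_sub L_sub disj]) simp_all
  have RL_disj: "{r l..b l} \<inter> {a l'..<r (l' - 1) + t (l' - 1)} = {}"
    if "j \<le> l" "l < p" "j < l'" "l' \<le> p" for l l'
  proof (cases "l = l'")
    case True
    then show ?thesis using valid_block_stepD[OF valid, of l] that by auto
  next
    case False
    then show ?thesis
      using that by (intro sub_disj[OF R_sub L_sub disj]) simp_all
  qed
  have "?R \<inter> ?L = {}"
  proof (rule equals0I)
    fix x assume "x \<in> ?R \<inter> ?L"
    then obtain l l' where "j \<le> l" "l < p" "j < l'" "l' \<le> p"
      "x \<in> {r l..b l}" "x \<in> {a l'..<r (l' - 1) + t (l' - 1)}" by auto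
    then show False using RL_disj[of l l'] by blast
  qed
  then have "(\<Prod>k\<in>?R \<union> ?L. f k) = (\<Prod>k\<in>?R. f k) * (\<Prod>k\<in>?L. f k)"
    by (intro prod.union_disjoint) simp_all
  also have "(\<Prod>k\<in>?R. f k) = (\<Prod>l\<in>{j..<p}. \<Prod>k\<in>{r l..b l}. f k)"
    by (intro prod.UNION_disjoint ballI impI R_disj) simp_all
  also have "(\<Prod>k\<in>?L. f k) = (\<Prod>l\<in>{j<..p}. \<Prod>k\<in>{a l..<r (l - 1) + t (l - 1)}. f k)"
    by (intro prod.UNION_disjoint ballI impI L_disj) simp_all
  finally show ?thesis by simp
qed

lemma mquot_eq_block:
  assumes m: "\<And>l. \<lbrakk>1 \<le> l; l \<le> d\<rbrakk> \<Longrightarrow> a l + m l = Suc (b l)"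
    and V: "\<And>l. \<lbrakk>1 \<le> l; l \<le> d\<rbrakk> \<Longrightarrow> V l \<subseteq> {1..n}"
    and jp: "1 \<le> j" "j < p" "p \<le> d"
    and adm: "admissible t a m j p q q'"
  shows "mquot n (\<Prod>l=j..p. \<Prod>k\<in>V l. mvar k)
      ((\<Prod>l=j..p-1. vlast a m q l) * (\<Prod>l=j+1..p. vfirst a q' l)) =
    (\<Prod>k\<in>block t V j p (\<lambda>l. b l - q l). mvar k :: 'k::field mpoly)"
proof -
  let ?r = "\<lambda>l. b l - q l"
  let ?R = "\<Union>l\<in>{j..<p}. {?r l..b l}"
  let ?L = "\<Union>l\<in>{j<..p}. {a l..<?r (l - 1) + t (l - 1)}"
  note valid = admissible_imp_valid_block(1)[OF m jp adm]
    and q_less = admissible_imp_valid_block(2)[OF m jp adm]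
    and link = admissible_imp_valid_block(3)[OF m jp adm]
  have numerator: "(\<Prod>l=j..p. \<Prod>k\<in>V l. mvar k) = (\<Prod>k\<in>(\<Union>l\<in>{j..p}. V l). mvar k :: 'k mpoly)"
  proof (rule prod.UNION_disjoint[symmetric])
    show "\<forall>l\<in>{j..p}. finite (V l)" using interval jp by auto
    show "\<forall>l\<in>{j..p}. \<forall>l'\<in>{j..p}. l \<noteq> l' \<longrightarrow> V l \<inter> V l' = {}"
      using jp by (intro ballI impI disjoint_parts) simp_all
  qed simp
  have "(\<Prod>l=j..p-1. vlast a m q l) = (\<Prod>l\<in>{j..<p}. \<Prod>k\<in>{?r l..b l}. mvar k :: 'k mpoly)"
  proof (rule prod.cong)
    show "{j..p - 1} = {j..<p}" using jp by auto
    fix l assume l: "l \<in> {j..<p}"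
    have "a l + m l = Suc (b l)" "q l < b l"
      using m[of l] q_less[of l] l jp by auto
    then show "vlast a m q l = (\<Prod>k\<in>{?r l..b l}. mvar k :: 'k mpoly)"
      by (subst vlast_eq_prod_interval) simp_all
  qed
  moreover have "(\<Prod>l=j+1..p. vfirst a q' l) =
      (\<Prod>l\<in>{j<..p}. \<Prod>k\<in>{a l..<?r (l - 1) + t (l - 1)}. mvar k :: 'k mpoly)"
  proof (rule prod.cong)
    show "{j + 1..p} = {j<..p}" by auto
    fix l assume l: "l \<in> {j<..p}"
    show "vfirst a q' l = (\<Prod>k\<in>{a l..<?r (l - 1) + t (l - 1)}. mvar k :: 'k mpoly)"
      using link[of l] l by (simp add: vfirst_eq_prod_interval atLeastLessThanSuc_atLeastAtMost)
  qed
  ultimately have denominator: "(\<Prod>l=j..p-1. vlast a m q l) * (\<Prod>l=j+1..p. vfirst a q' l) =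
      (\<Prod>k\<in>?R \<union> ?L. mvar k :: 'k mpoly)"
    using prod_removed_variables[OF valid, of mvar] by simp
  have "?R \<union> ?L \<subseteq> (\<Union>l\<in>{j..p}. V l)"
  proof (intro Un_least UN_least)
    show "{?r l..b l} \<subseteq> (\<Union>l\<in>{j..p}. V l)" if l: "l \<in> {j..<p}" for l
    proof -
      have "{?r l..b l} \<subseteq> V l"
        using l by (intro valid_block_right_part[OF valid]) simp_all
      also have "V l \<subseteq> (\<Union>l\<in>{j..p}. V l)"
        using l by (intro UN_upper) simp
      finally show ?thesis .
    qed
    show "{a l..<?r (l - 1) + t (l - 1)} \<subseteq> (\<Union>l\<in>{j..p}. V l)" if l: "l \<in> {j<..p}" for l
    proof -
      have "{a l..<?r (l - 1) + t (l - 1)} \<subseteq> V l"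
        using l by (intro valid_block_left_part[OF valid]) simp_all
      also have "V l \<subseteq> (\<Union>l\<in>{j..p}. V l)"
        using l by (intro UN_upper) simp
      finally show ?thesis .
    qed
  qed
  moreover have "(\<Union>l\<in>{j..p}. V l) \<subseteq> {1..n}"
    using V jp by (intro UN_least) auto
  ultimately have "mquot n (\<Prod>k\<in>(\<Union>l\<in>{j..p}. V l). mvar k) (\<Prod>k\<in>?R \<union> ?L. mvar k) =
      (\<Prod>k\<in>(\<Union>l\<in>{j..p}. V l) - (?R \<union> ?L). mvar k :: 'k mpoly)"
    by (intro mquot_prod_mvar)
  also have "(\<Union>l\<in>{j..p}. V l) - (?R \<union> ?L) = block t V j p ?r"
    using block_eq_Diff[OF valid] by (rule sym)
  finally show ?thesis
    unfolding numerator denominator .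
qed

text \<open>
  Blocks within a single class give the monomials of the first kind, all other blocks those of the
  second kind, with \<open>q l = b l - r l\<close>.
\<close>

theorem block_monomials:
  assumes m: "\<And>l. \<lbrakk>1 \<le> l; l \<le> d\<rbrakk> \<Longrightarrow> a l + m l = Suc (b l)"
    and V: "\<And>l. \<lbrakk>1 \<le> l; l \<le> d\<rbrakk> \<Longrightarrow> V l \<subseteq> {1..n}"
  shows "{(\<Prod>k\<in>block t V j p r. mvar k :: 'k::field mpoly) | j p r. valid_block j p r} =
    {(\<Prod>k\<in>V j. mvar k) | j. j \<in> {1..d}} \<union>
    {mquot n (\<Prod>l=j..p. \<Prod>k\<in>V l. mvar k)
             ((\<Prod>l=j..p-1. vlast a m q l) * (\<Prod>l=j+1..p. vfirst a q' l))
      | j p q q'. 1 \<le> j \<and> j < p \<and> p \<le> d \<and> admissible t a m j p q q'}"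
    (is "?B = ?S \<union> ?Q")
proof (intro equalityI subsetI)
  fix u assume "u \<in> ?B"
  then obtain j p r where valid: "valid_block j p r" and u: "u = (\<Prod>k\<in>block t V j p r. mvar k)"
    by blast
  have jp: "1 \<le> j" "j \<le> p" "p \<le> d" using valid by (auto simp: valid_block_def)
  show "u \<in> ?S \<union> ?Q"
  proof (cases "j = p")
    case True
    then have "u = (\<Prod>k\<in>V j. mvar k)" by (simp add: u block_def)
    then show ?thesis using jp by auto
  next
    case False
    then have less: "j < p" using jp by simp
    let ?q = "\<lambda>l. b l - r l" and ?q' = "\<lambda>l. r (l - 1) + t (l - 1) - 1 - a l"
    have adm: "admissible t a m j p ?q ?q'"
      using m valid by (rule valid_block_imp_admissible)
    have "b l - ?q l = r l" if "j \<le> l" "l < p" for l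
      using valid_block_memD[OF valid that] by simp
    then have "block t V j p (\<lambda>l. b l - ?q l) = block t V j p r"
      by (rule block_cong)
    then have "u = (\<Prod>k\<in>block t V j p (\<lambda>l. b l - ?q l). mvar k)"
      by (simp only: u)
    also have "\<dots> = mquot n (\<Prod>l=j..p. \<Prod>k\<in>V l. mvar k)
        ((\<Prod>l=j..p-1. vlast a m ?q l) * (\<Prod>l=j+1..p. vfirst a ?q' l))"
      by (rule mquot_eq_block[OF m V jp(1) less jp(3) adm, symmetric])
    finally have "u \<in> ?Q" using jp(1,3) less adm by blast
    then show ?thesis by (rule UnI2)
  qed
next
  fix u assume "u \<in> ?S \<union> ?Q"
  then show "u \<in> ?B"
  proof
    assume "u \<in> ?S"
    then obtain j where j: "1 \<le> j" "j \<le> d" "u = (\<Prod>k\<in>V j. mvar k)" by auto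
    have "valid_block j j a" "block t V j j a = V j"
      using j by (auto simp: valid_block_def block_def)
    then have "u = (\<Prod>k\<in>block t V j j a. mvar k)"
      using j(3) by simp
    then show ?thesis using \<open>valid_block j j a\<close> by blast
  next
    assume "u \<in> ?Q"
    then obtain j p q q' where jp: "1 \<le> j" "j < p" "p \<le> d" and adm: "admissible t a m j p q q'"
      and u: "u = mquot n (\<Prod>l=j..p. \<Prod>k\<in>V l. mvar k)
             ((\<Prod>l=j..p-1. vlast a m q l) * (\<Prod>l=j+1..p. vfirst a q' l))"
      by blast
    have "u = (\<Prod>k\<in>block t V j p (\<lambda>l. b l - q l). mvar k)"
      unfolding u using m V jp adm by (rule mquot_eq_block)
    then show ?thesis
      using admissible_imp_valid_block(1)[OF m jp adm] by blast
  qed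
qed

end

text \<open>
  The second conclusion amounts to \<open>m j > 0\<close>, in the form that lets the length \<open>m j\<close> be exchanged for
  the right end point.
\<close>

lemma interval_spread_hypergraph:
  assumes V: "vertex_family n d V"
    and isolated: "no_isolated_vertices (complete_spread_hypergraph d t V)"
    and interval: "\<forall>j\<in>{1..d}. card (V j) = m j \<and> V j = {i j..i j + m j - 1}"
  shows "interval_spread d t i (\<lambda>j. i j + m j - 1) V"
    and "\<And>j. \<lbrakk>1 \<le> j; j \<le> d\<rbrakk> \<Longrightarrow> i j + m j = Suc (i j + m j - 1)"
proof -
  have V_int: "V l = {i l..i l + m l - 1}" and card: "card (V l) = m l" if "1 \<le> l" "l \<le> d" for l
    using bspec[OF interval, of l] that unfolding atLeastAtMost_iff by blast+
  have V_ne: "V l \<noteq> {}" if "1 \<le> l" "l \<le> d" for l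
    using V that by (simp add: vertex_family_def)
  have disjoint: "V l \<inter> V l' = {}" if "1 \<le> l" "l \<le> d" "1 \<le> l'" "l' \<le> d" "l \<noteq> l'" for l l'
    using V that by (simp add: vertex_family_def)
  show "i l + m l = Suc (i l + m l - 1)" if l: "1 \<le> l" "l \<le> d" for l
  proof -
    have "finite (V l)" using V_int[OF l] by simp
    then have "0 < m l" using V_ne[OF l] card[OF l] by (metis card_gt_0_iff)
    then show ?thesis by simp
  qed
  show "interval_spread d t i (\<lambda>j. i j + m j - 1) V"
  proof
    show "V l = {i l..i l + m l - 1}" if "1 \<le> l" "l \<le> d" for l
      using that by (rule V_int)
    show le: "i l \<le> i l + m l - 1" if "1 \<le> l" "l \<le> d" for l
      using V_int[OF that] V_ne[OF that] by simp
    show "i l + m l - 1 < i l'" if l: "1 \<le> l" "l < l'" "l' \<le> d" for l l'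
    proof -
      have "i l + m l - 1 \<in> V l" "i l' \<in> V l'"
        using V_int[of l] V_int[of l'] le[of l] le[of l'] l by auto
      then show ?thesis
        using V[unfolded vertex_family_def, THEN conjunct2, THEN conjunct2, rule_format, of l l'] l
        by auto
    qed
    show "\<exists>s. spread_chain d t V s \<and> s l = x" if l: "1 \<le> l" "l \<le> d" and x: "x \<in> V l" for l x
    proof -
      have "\<exists>e\<in>spread_edges d t V. x \<in> e"
        using isolated l x by (auto simp: no_isolated_vertices_def complete_spread_hypergraph_def)
      then obtain s where s: "spread_chain d t V s" "x \<in> s ` {1..d}"
        unfolding spread_edges_eq_chains by blast
      then obtain l' where l': "1 \<le> l'" "l' \<le> d" "s l' = x" by auto
      have "l' = l"
        using chain_mem[OF s(1) l'(1,2)] disjoint[OF l'(1,2) l] l'(3) x by blast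
      then show ?thesis using s(1) l'(3) by blast
    qed
  qed
qed

theorem theorem4p1:
  fixes n d :: nat and t i m :: "nat \<Rightarrow> nat" and V :: "nat \<Rightarrow> nat set"
  assumes "n \<ge> 1" and "d \<ge> 1"
    and "\<forall>j\<in>{1..d-1}. t j \<ge> 1"
    and "vertex_family n d V"
    and "no_isolated_vertices (complete_spread_hypergraph d t V)"
    and "\<forall>j\<in>{1..d}. card (V j) = m j \<and> V j = {i j..i j + m j - 1}"
  shows "min_gens n (alexander_dual n
            (edge_ideal n (complete_spread_hypergraph d t V) :: ('k::field mpoly) set)) =
         {(\<Prod>k\<in>V j. mvar k) | j. j \<in> {1..d}} \<union>
         {mquot n (\<Prod>l=j..p. \<Prod>k\<in>V l. mvar k)
                  ((\<Prod>l=j..p-1. vlast i m q l) * (\<Prod>l=j+1..p. vfirst i q' l))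
           | j p q q'. 1 \<le> j \<and> j < p \<and> p \<le> d \<and> admissible t i m j p q q'}"
proof -
  interpret interval_spread d t i "\<lambda>j. i j + m j - 1" V
    using assms(4-6) by (rule interval_spread_hypergraph(1))
  have V: "V l \<subseteq> {1..n}" if "1 \<le> l" "l \<le> d" for l
    using assms(4) that by (simp add: vertex_family_def)
  have "\<forall>e\<in>spread_edges d t V. e \<subseteq> {1..n}"
  proof
    fix e assume "e \<in> spread_edges d t V"
    then obtain s where s: "e = s ` {1..d}" "spread_chain d t V s"
      unfolding spread_edges_eq_chains by blast
    show "e \<subseteq> {1..n}"
      unfolding s(1) using chain_mem[OF s(2)] V by (intro image_subsetI) (meson atLeastAtMost_iff subsetD)
  qed
  then have "min_gens n (alexander_dual n
        (edge_ideal n (complete_spread_hypergraph d t V) :: 'k mpoly set)) =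
      (\<lambda>C. \<Prod>k\<in>C. mvar k) ` minimal_covers (spread_edges d t V)"
    unfolding complete_spread_hypergraph_def
    using edges_antichain by (rule min_gens_alexander_dual)
  also have "\<dots> = {(\<Prod>k\<in>block t V j p r. mvar k) | j p r. valid_block j p r}"
    unfolding minimal_covers_eq_blocks by blast
  also note block_monomials[of m n, OF interval_spread_hypergraph(2)[OF assms(4-6)] V]
  finally show ?thesis .
qed

end
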